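(* There is a polynomial-time algorithm that solves the Stochastic Boolean Function Evaluation problem for linear threshold formulas with integer coefficients with approximation factor $3$: for every linear threshold formula $\sum_{i=1}^n a_i x_i\ge\theta$ with integers $a_1,\dots,a_n,\theta$, every probability vector $p\in(0,1)^n$ and every cost vector $c\ge0$, the expected testing cost of the algorithm is at most $3$ times the minimum expected testing cost of any strategy that evaluates the function.
   Context: The linear threshold formula $\sum_{i=1}^n a_ix_i\ge\theta$ represents $f:\{0,1\}^n\to\{0,1\}$ with $f(x)=1$ iff $\sum_i a_ix_i\ge\theta$. Stochastic Boolean Function Evaluation (SBFE): input is a representation of $f$, $p=(p_1,\dots,p_n)$ with $0<p_i<1$, and costs $c_i\ge0$. An unknown $x\in\{0,1\}^n$ is drawn from the product distribution with $\Pr[x_i=1]=p_i$; $x_i$ can be learned only by testing $i$ at cost $c_i$. A strategy adaptively tests variables until the observed partial assignment $b\in\{0,1,*\}^n$ is a $0$-certificate or $1$-certificate of $f$ (i.e. $f$ is constant on all $a\in\{0,1\}^n$ agreeing with $b$ on its non-$*$ coordinates), then outputs $f(x)$. Its cost is the expected total testing cost; an optimal strategy minimizes it. The running time is the worst-case time to determine the next variable to test or to compute the output. *)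

theory Defs
  imports "HOL-Probability.Probability" "HOL-Computational_Algebra.Polynomial"
    "HOL-Library.Log_Nat"
begin

section \<open>Stochastic evaluation of linear threshold formulas\<close>

text \<open>
  A point of \<open>{0,1}\<^sup>n\<close> is a function \<open>nat \<Rightarrow> bool\<close> of which only the coordinates \<open>i < n\<close> matter;
  coordinates are numbered from \<open>0\<close>. A partial assignment is a map \<open>nat \<rightharpoonup> bool\<close>
  with domain in \<open>{..<n}\<close>, the value \<open>None\<close> standing for \<open>*\<close>.
\<close>

record ltf_instance =
  dim :: nat
  coef :: "nat \<Rightarrow> int"
  threshold :: int
  prob :: "nat \<Rightarrow> real"
  cost :: "nat \<Rightarrow> real"

definition valid_instance :: "ltf_instance \<Rightarrow> bool" where
  "valid_instance I \<longleftrightarrow> (\<forall>i<dim I. 0 < prob I i \<and> prob I i < 1 \<and> 0 \<le> cost I i)"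

definition rational_instance :: "ltf_instance \<Rightarrow> bool" where
  "rational_instance I \<longleftrightarrow> (\<forall>i<dim I. prob I i \<in> \<rat> \<and> cost I i \<in> \<rat>)"

definition ltf :: "ltf_instance \<Rightarrow> (nat \<Rightarrow> bool) \<Rightarrow> bool" where
  "ltf I x \<longleftrightarrow> (\<Sum>i<dim I. coef I i * of_bool (x i)) \<ge> threshold I"

definition certificate :: "((nat \<Rightarrow> bool) \<Rightarrow> bool) \<Rightarrow> (nat \<rightharpoonup> bool) \<Rightarrow> bool \<Rightarrow> bool" where
  "certificate f b v \<longleftrightarrow> (\<forall>x. (\<forall>i w. b i = Some w \<longrightarrow> x i = w) \<longrightarrow> f x = v)"

text \<open>In \<open>Test i T\<^sub>0 T\<^sub>1\<close> the strategy continues with \<open>T\<^sub>0\<close> if \<open>x\<^sub>i = 0\<close> and with \<open>T\<^sub>1\<close> if \<open>x\<^sub>i = 1\<close>.\<close>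

datatype strategy = Output bool | Test nat strategy strategy

fun evaluates :: "((nat \<Rightarrow> bool) \<Rightarrow> bool) \<Rightarrow> nat \<Rightarrow> (nat \<rightharpoonup> bool) \<Rightarrow> strategy \<Rightarrow> bool" where
  "evaluates f n b (Output v) \<longleftrightarrow> certificate f b v"
| "evaluates f n b (Test i T0 T1) \<longleftrightarrow>
     i < n \<and> b i = None \<and> \<not> certificate f b False \<and> \<not> certificate f b True \<and>
     evaluates f n (b(i \<mapsto> False)) T0 \<and> evaluates f n (b(i \<mapsto> True)) T1"

fun testing_cost :: "(nat \<Rightarrow> real) \<Rightarrow> strategy \<Rightarrow> (nat \<Rightarrow> bool) \<Rightarrow> real" where
  "testing_cost c (Output v) x = 0"
| "testing_cost c (Test i T0 T1) x = c i + testing_cost c (if x i then T1 else T0) x"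

definition expected_cost :: "ltf_instance \<Rightarrow> strategy \<Rightarrow> real" where
  "expected_cost I T =
     measure_pmf.expectation (Pi_pmf {..<dim I} False (\<lambda>i. bernoulli_pmf (prob I i)))
       (testing_cost (cost I) T)"

definition strategies :: "ltf_instance \<Rightarrow> strategy set" where
  "strategies I = {T. evaluates (ltf I) (dim I) Map.empty T}"

definition opt_cost :: "ltf_instance \<Rightarrow> real" where
  "opt_cost I = Min (expected_cost I ` strategies I)"

text \<open>The minimum defining \<^const>\<open>opt_cost\<close> is over a finite nonempty set.\<close>

lemma finite_evaluates: "finite {T. evaluates f n b T}"
proof (induction "card ({..<n} - dom b)" arbitrary: b rule: less_induct)
  case less
  let ?J = "{..<n} - dom b"
  let ?S = "\<lambda>i v. {T. evaluates f n (b(i \<mapsto> v)) T}"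
  have fin: "finite (?S i v)" if "i \<in> ?J" for i v
  proof (rule less)
    have "{..<n} - dom (b(i \<mapsto> v)) \<subset> ?J" using that by auto
    then show "card ({..<n} - dom (b(i \<mapsto> v))) < card ?J"
      by (intro psubset_card_mono) auto
  qed
  have "{T. evaluates f n b T} \<subseteq>
      Output ` UNIV \<union> (\<Union>i\<in>?J. (\<lambda>(T0, T1). Test i T0 T1) ` (?S i False \<times> ?S i True))"
  proof
    fix T assume "T \<in> {T. evaluates f n b T}"
    then show "T \<in> Output ` UNIV \<union> (\<Union>i\<in>?J. (\<lambda>(T0, T1). Test i T0 T1) ` (?S i False \<times> ?S i True))"
    proof (cases T)
      case (Test i T0 T1)
      with \<open>T \<in> _\<close> have "i \<in> ?J" "(T0, T1) \<in> ?S i False \<times> ?S i True"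
        by (auto simp: dom_def)
      moreover have "T = (\<lambda>(T0, T1). Test i T0 T1) (T0, T1)" using Test by simp
      ultimately show ?thesis by blast
    qed blast
  qed
  moreover have "finite (Output ` UNIV \<union>
      (\<Union>i\<in>?J. (\<lambda>(T0, T1). Test i T0 T1) ` (?S i False \<times> ?S i True)))"
    using fin by (intro finite_UnI finite_UN_I finite_imageI finite_cartesian_product) simp_all
  ultimately show ?case by (rule finite_subset)
qed

lemma ex_evaluates:
  assumes "\<And>x y. (\<And>i. i < n \<Longrightarrow> x i = y i) \<Longrightarrow> f x = f y"
  shows "\<exists>T. evaluates f n b T"
proof (induction "card ({..<n} - dom b)" arbitrary: b rule: less_induct)
  case less
  show ?case
  proof (cases "\<exists>v. certificate f b v")
    case True
    then obtain v where "certificate f b v" by blast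
    then have "evaluates f n b (Output v)" by simp
    then show ?thesis by blast
  next
    case False
    have "\<exists>i<n. b i = None"
    proof (rule ccontr)
      assume full: "\<not> (\<exists>i<n. b i = None)"
      have "certificate f b (f (\<lambda>i. the (b i)))"
        unfolding certificate_def
      proof (intro allI impI assms)
        fix x i assume "\<forall>i w. b i = Some w \<longrightarrow> x i = w" "i < n"
        moreover obtain w where "b i = Some w" using full \<open>i < n\<close> by (cases "b i") auto
        ultimately show "x i = the (b i)" by simp
      qed
      with False show False by blast
    qed
    then obtain i where i: "i < n" "b i = None" by blast
    have "\<exists>T. evaluates f n (b(i \<mapsto> v)) T" for v
    proof (rule less)
      have "{..<n} - dom (b(i \<mapsto> v)) \<subset> {..<n} - dom b" using i by auto
      then show "card ({..<n} - dom (b(i \<mapsto> v))) < card ({..<n} - dom b)"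
        by (intro psubset_card_mono) auto
    qed
    then obtain T0 T1 where "evaluates f n (b(i \<mapsto> False)) T0" "evaluates f n (b(i \<mapsto> True)) T1"
      by blast
    with i False have "evaluates f n b (Test i T0 T1)" by simp
    then show ?thesis by blast
  qed
qed

lemma finite_strategies: "finite (strategies I)"
  unfolding strategies_def by (rule finite_evaluates)

lemma strategies_nonempty: "strategies I \<noteq> {}"
proof -
  have "\<exists>T. evaluates (ltf I) (dim I) Map.empty T"
  proof (rule ex_evaluates)
    fix x y :: "nat \<Rightarrow> bool"
    assume "\<And>i. i < dim I \<Longrightarrow> x i = y i"
    then have "(\<Sum>i<dim I. coef I i * of_bool (x i)) = (\<Sum>i<dim I. coef I i * of_bool (y i))"
      by (intro sum.cong) simp_all
    then show "ltf I x = ltf I y" unfolding ltf_def by (rule arg_cong)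
  qed
  then show ?thesis unfolding strategies_def by blast
qed


section \<open>Algorithms\<close>

text \<open>
  A random access machine in structured form. A state holds natural number variables, used for
  counting and addressing, and arrays of numbers. Numeric literals in programs are integers, so
  that a program is a finite object. A number is taken to be a real; starting from rational data,
  a program only ever produces rationals.
\<close>

type_synonym vname = string

record state =
  nvar :: "vname \<Rightarrow> nat"
  arr :: "vname \<Rightarrow> nat \<Rightarrow> real"

datatype iexp = IConst nat | IVar vname | IAdd iexp iexp | ISub iexp iexp

datatype rexp = RConst int | RNat iexp | RArr vname iexp
  | RAdd rexp rexp | RSub rexp rexp | RMul rexp rexp | RDiv rexp rexp

datatype bexp = ILess iexp iexp | RLess rexp rexp | BNot bexp | BAnd bexp bexp

datatype com = Skip | IAssign vname iexp | RAssign vname iexp rexp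
  | Seq com com | Cond bexp com com | While bexp com

fun ival :: "iexp \<Rightarrow> state \<Rightarrow> nat" where
  "ival (IConst k) s = k"
| "ival (IVar x) s = nvar s x"
| "ival (IAdd d e) s = ival d s + ival e s"
| "ival (ISub d e) s = ival d s - ival e s"

fun rval :: "rexp \<Rightarrow> state \<Rightarrow> real" where
  "rval (RConst k) s = of_int k"
| "rval (RNat e) s = real (ival e s)"
| "rval (RArr x e) s = arr s x (ival e s)"
| "rval (RAdd d e) s = rval d s + rval e s"
| "rval (RSub d e) s = rval d s - rval e s"
| "rval (RMul d e) s = rval d s * rval e s"
| "rval (RDiv d e) s = rval d s / rval e s"

fun bval :: "bexp \<Rightarrow> state \<Rightarrow> bool" where
  "bval (ILess d e) s \<longleftrightarrow> ival d s < ival e s"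
| "bval (RLess d e) s \<longleftrightarrow> rval d s < rval e s"
| "bval (BNot d) s \<longleftrightarrow> \<not> bval d s"
| "bval (BAnd d e) s \<longleftrightarrow> bval d s \<and> bval e s"

text \<open>
  Time is charged relative to a weight \<open>w\<close>: every number or address that is read, or computed as
  an intermediate result, contributes its weight. Constant weight \<open>1\<close> counts arithmetic
  operations (the real RAM); the bit length of a reduced fraction gives the logarithmic cost
  criterion, which is polynomially equivalent to Turing machine time.
\<close>

fun icost :: "(real \<Rightarrow> nat) \<Rightarrow> iexp \<Rightarrow> state \<Rightarrow> nat" where
  "icost w (IConst k) s = w (real k)"
| "icost w (IVar x) s = w (real (nvar s x))"
| "icost w (IAdd d e) s = icost w d s + icost w e s + w (real (ival (IAdd d e) s))"
| "icost w (ISub d e) s = icost w d s + icost w e s + w (real (ival (ISub d e) s))"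

fun rcost :: "(real \<Rightarrow> nat) \<Rightarrow> rexp \<Rightarrow> state \<Rightarrow> nat" where
  "rcost w (RConst k) s = w (of_int k)"
| "rcost w (RNat e) s = icost w e s + w (rval (RNat e) s)"
| "rcost w (RArr x e) s = icost w e s + w (rval (RArr x e) s)"
| "rcost w (RAdd d e) s = rcost w d s + rcost w e s + w (rval (RAdd d e) s)"
| "rcost w (RSub d e) s = rcost w d s + rcost w e s + w (rval (RSub d e) s)"
| "rcost w (RMul d e) s = rcost w d s + rcost w e s + w (rval (RMul d e) s)"
| "rcost w (RDiv d e) s = rcost w d s + rcost w e s + w (rval (RDiv d e) s)"

fun bcost :: "(real \<Rightarrow> nat) \<Rightarrow> bexp \<Rightarrow> state \<Rightarrow> nat" where
  "bcost w (ILess d e) s = icost w d s + icost w e s + 1"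
| "bcost w (RLess d e) s = rcost w d s + rcost w e s + 1"
| "bcost w (BNot d) s = bcost w d s + 1"
| "bcost w (BAnd d e) s = bcost w d s + bcost w e s + 1"

text \<open>\<open>exec w P s t s'\<close>: started in \<open>s\<close>, the program \<open>P\<close> halts in \<open>s'\<close> after time \<open>t\<close>.\<close>

inductive exec :: "(real \<Rightarrow> nat) \<Rightarrow> com \<Rightarrow> state \<Rightarrow> nat \<Rightarrow> state \<Rightarrow> bool" for w where
  Skip: "exec w Skip s 1 s"
| IAssign: "exec w (IAssign x e) s (icost w e s + 1)
    (s\<lparr>nvar := (nvar s)(x := ival e s)\<rparr>)"
| RAssign: "exec w (RAssign x d e) s (icost w d s + rcost w e s + 1)
    (s\<lparr>arr := (arr s)(x := (arr s x)(ival d s := rval e s))\<rparr>)"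
| Seq: "exec w P s t s' \<Longrightarrow> exec w Q s' u s'' \<Longrightarrow> exec w (Seq P Q) s (t + u) s''"
| CondTrue: "bval d s \<Longrightarrow> exec w P s t s' \<Longrightarrow> exec w (Cond d P Q) s (bcost w d s + t) s'"
| CondFalse: "\<not> bval d s \<Longrightarrow> exec w Q s t s' \<Longrightarrow> exec w (Cond d P Q) s (bcost w d s + t) s'"
| WhileFalse: "\<not> bval d s \<Longrightarrow> exec w (While d P) s (bcost w d s) s"
| WhileTrue: "bval d s \<Longrightarrow> exec w P s t s' \<Longrightarrow> exec w (While d P) s' u s'' \<Longrightarrow>
    exec w (While d P) s (bcost w d s + t + u) s''"

definition unit_weight :: "real \<Rightarrow> nat" where
  "unit_weight r = 1"

text \<open>Only meaningful for rational arguments.\<close>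

definition bit_weight :: "real \<Rightarrow> nat" where
  "bit_weight r =
     (case quotient_of (inv real_of_rat r) of (k, m) \<Rightarrow> nat (bitlen \<bar>k\<bar>) + nat (bitlen m) + 1)"

text \<open>
  An algorithm for the evaluation problem is a program that is given an instance together with the
  partial assignment \<open>b\<close> observed so far, and determines what to do next. In the array \<open>b\<close> of the
  initial state, \<open>2\<close> stands for \<open>*\<close>. The decision is read off the variable \<open>result\<close>: \<open>0\<close> and \<open>1\<close>
  are outputs, and \<open>i + 2\<close> asks for variable \<open>i\<close> to be tested.
\<close>

definition initial_state :: "ltf_instance \<Rightarrow> (nat \<rightharpoonup> bool) \<Rightarrow> state" where
  "initial_state I b = \<lparr>
     nvar = (\<lambda>_. 0)(''n'' := dim I),
     arr = (\<lambda>_ _. 0)(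
       ''a'' := (\<lambda>i. if i < dim I then of_int (coef I i) else 0),
       ''theta'' := (\<lambda>i. if i = 0 then of_int (threshold I) else 0),
       ''p'' := (\<lambda>i. if i < dim I then prob I i else 0),
       ''c'' := (\<lambda>i. if i < dim I then cost I i else 0),
       ''b'' := (\<lambda>i. if i < dim I then case b i of None \<Rightarrow> 2 | Some v \<Rightarrow> of_bool v else 0))\<rparr>"

definition instance_size :: "(real \<Rightarrow> nat) \<Rightarrow> ltf_instance \<Rightarrow> nat" where
  "instance_size w I = w (of_int (threshold I)) +
     (\<Sum>i<dim I. w (of_int (coef I i)) + w (prob I i) + w (cost I i) + 1)"

definition poly_time :: "(real \<Rightarrow> nat) \<Rightarrow> ltf_instance set \<Rightarrow> com \<Rightarrow> bool" where
  "poly_time w A P \<longleftrightarrow> (\<exists>q :: nat poly. \<forall>I\<in>A. \<forall>b. dom b \<subseteq> {..<dim I} \<longrightarrow>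
     (\<exists>t s. exec w P (initial_state I b) t s \<and> t \<le> poly q (instance_size w I)))"

text \<open>\<open>follows P I b T\<close>: from the observations \<open>b\<close> on, the tests and outputs of \<open>P\<close> are those of \<open>T\<close>.\<close>

inductive follows :: "com \<Rightarrow> ltf_instance \<Rightarrow> (nat \<rightharpoonup> bool) \<Rightarrow> strategy \<Rightarrow> bool" for P I where
  Output: "exec unit_weight P (initial_state I b) t s \<Longrightarrow> nvar s ''result'' = of_bool v \<Longrightarrow>
    follows P I b (Output v)"
| Test: "exec unit_weight P (initial_state I b) t s \<Longrightarrow> nvar s ''result'' = i + 2 \<Longrightarrow>
    follows P I (b(i \<mapsto> False)) T0 \<Longrightarrow> follows P I (b(i \<mapsto> True)) T1 \<Longrightarrow>
    follows P I b (Test i T0 T1)"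

end

theory Submission
  imports Defs
begin

text \<open>
  For observations \<open>b\<close> let \<open>N\<^sub>1\<close> be the amount by which the minimum of the linear form must still
  rise to give a \<open>1\<close>-certificate, and \<open>N\<^sub>0\<close> the amount by which its maximum must still fall to give
  a \<open>0\<close>-certificate. A test of \<open>i\<close> moves one of the two by \<open>\<bar>a\<^sub>i\<bar>\<close>; its gain is
  \<open>min \<bar>a\<^sub>i\<bar> N\<^sub>1 * N\<^sub>0\<close> or \<open>min \<bar>a\<^sub>i\<bar> N\<^sub>0 * N\<^sub>1\<close>, with all quantities taken at \<open>b\<close>. Suppose that the
  cost of every test is its expected gain. Any strategy that evaluates the formula from \<open>b\<close> collects
  gains of at least \<open>N\<^sub>1 * N\<^sub>0\<close> on every path, and of at most \<open>3 * N\<^sub>1 * N\<^sub>0\<close>, since before its last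
  test each of the two amounts is not yet exhausted. For these costs every strategy is therefore
  \<open>3\<close>-approximate.

  Given arbitrary costs, subtract the largest multiple of the expected gains that keeps them
  nonnegative. Some useful variable becomes free; test it and recurse with the reduced costs. By the
  local ratio argument the resulting strategy is \<open>3\<close>-approximate. This is the adaptive dual greedy
  algorithm. Its reduced costs stay of polynomial bit length, because every round contributes one
  factor of polynomial length to their common denominator.
\<close>

section \<open>Expected costs of strategies\<close>

text \<open>Why these gains: since min |a| N1 * N0 = N1 * N0 - max (N1 - |a|) 0 * N0, a gain is the
  decrease that one test causes in the product of the two amounts, cut off at 0. That product
  vanishes exactly when one of the two certificates is present, so a disjunction of two linear goals
  becomes one quantity. The gains are frozen at \<open>b\<close> because the local ratio step needs
  one cost vector for the whole remaining strategy. Freezing loses exactness: progress towards each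
  certificate may be counted up to N1 * N0, although one of them suffices, and the last test may
  overshoot. The cap in the gain limits this overshoot to one more N1 * N0, however large the
  coefficient is. A further obstacle lies in the model: a strategy may neither repeat a test nor go
  on after a certificate. Restricting the optimum to an answer of the picked variable therefore
  means rebuilding and pruning its tree.\<close>

fun ecost :: "(nat \<Rightarrow> real) \<Rightarrow> (nat \<Rightarrow> real) \<Rightarrow> strategy \<Rightarrow> real" where
  "ecost p c (Output v) = 0"
| "ecost p c (Test i T0 T1) = c i + (1 - p i) * ecost p c T0 + p i * ecost p c T1"

fun tests :: "strategy \<Rightarrow> nat set" where
  "tests (Output v) = {}"
| "tests (Test i T0 T1) = insert i (tests T0 \<union> tests T1)"

lemma tests_evaluates: "evaluates f n b T \<Longrightarrow> tests T \<subseteq> {..<n} - dom b"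
  by (induction T arbitrary: b) fastforce+

lemma testing_cost_upd: "i \<notin> tests T \<Longrightarrow> testing_cost c T (x(i := v)) = testing_cost c T x"
  by (induction T) auto

lemma finite_set_Pi_bernoulli:
  assumes "finite A"
  shows "finite (set_pmf (Pi_pmf A False (\<lambda>i. bernoulli_pmf (p i))))"
proof (rule finite_subset)
  show "set_pmf (Pi_pmf A False (\<lambda>i. bernoulli_pmf (p i))) \<subseteq> PiE_dflt A False (\<lambda>_. UNIV)"
    using assms by (auto simp: set_Pi_pmf PiE_dflt_def)
  show "finite (PiE_dflt A False (\<lambda>_. UNIV :: bool set))"
    using assms by (intro finite_PiE_dflt) auto
qed

text \<open>Conditioning on coordinate \<open>i\<close>: the product distribution is a Bernoulli
  draw for \<open>i\<close> followed by an independent draw of the other coordinates.\<close>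

lemma expectation_Pi_bernoulli_split:
  fixes h :: "(nat \<Rightarrow> bool) \<Rightarrow> real"
  assumes A: "finite A" and i: "i \<in> A" and p: "0 \<le> p i" "p i \<le> 1"
  defines "P \<equiv> \<lambda>B. Pi_pmf B False (\<lambda>i. bernoulli_pmf (p i))"
  shows "measure_pmf.expectation (P A) h =
    (1 - p i) * measure_pmf.expectation (P (A - {i})) (\<lambda>x. h (x(i := False))) +
    p i * measure_pmf.expectation (P (A - {i})) (\<lambda>x. h (x(i := True)))"
proof -
  have eq: "P A = bind_pmf (bernoulli_pmf (p i)) (\<lambda>y. map_pmf (\<lambda>x. x(i := y)) (P (A - {i})))"
    using A i Pi_pmf_insert'[of "A - {i}" i False "\<lambda>i. bernoulli_pmf (p i)"]
    unfolding P_def by (simp add: insert_absorb map_pmf_def)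
  have "measure_pmf.expectation (P A) h =
      (\<Sum>y\<in>UNIV. pmf (bernoulli_pmf (p i)) y *\<^sub>R
        measure_pmf.expectation (map_pmf (\<lambda>x. x(i := y)) (P (A - {i}))) h)"
    unfolding eq
    by (rule pmf_expectation_bind) (use A in \<open>auto simp: P_def finite_set_Pi_bernoulli\<close>)
  then show ?thesis using p by (simp add: UNIV_bool)
qed

lemma expectation_testing_cost:
  assumes "\<And>i. i < n \<Longrightarrow> 0 \<le> p i \<and> p i \<le> 1" and "evaluates f n b T"
  shows "measure_pmf.expectation (Pi_pmf {..<n} False (\<lambda>i. bernoulli_pmf (p i)))
    (testing_cost c T) = ecost p c T"
  using assms(2)
proof (induction T arbitrary: b)
  case (Test i T0 T1)
  let ?E = "\<lambda>B. measure_pmf.expectation (Pi_pmf B False (\<lambda>i. bernoulli_pmf (p i)))"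
  have i: "i < n" "0 \<le> p i" "p i \<le> 1" and ev: "evaluates f n (b(i \<mapsto> False)) T0"
    "evaluates f n (b(i \<mapsto> True)) T1"
    using Test.prems assms(1) by auto
  then have nin: "i \<notin> tests T0" "i \<notin> tests T1" using tests_evaluates by fastforce+
  note split = expectation_Pi_bernoulli_split[where A = "{..<n}" and i = i and p = p]
  \<comment> \<open>The induction hypothesis speaks of all coordinates, while the split leaves those
    other than \<open>i\<close>. Since \<open>T0\<close> never tests \<open>i\<close>, splitting its
    expectation yields twice the same term, with weights adding up to 1.\<close>
  have T0: "ecost p c T0 = ?E ({..<n} - {i}) (testing_cost c T0)"
    using Test.IH(1)[OF ev(1)] split[where h = "testing_cost c T0"] i nin
    by (simp add: testing_cost_upd algebra_simps)
  have T1: "ecost p c T1 = ?E ({..<n} - {i}) (testing_cost c T1)"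
    using Test.IH(2)[OF ev(2)] split[where h = "testing_cost c T1"] i nin
    by (simp add: testing_cost_upd algebra_simps)
  have int: "integrable (measure_pmf (Pi_pmf ({..<n} - {i}) False (\<lambda>i. bernoulli_pmf (p i)))) h"
    for h :: "_ \<Rightarrow> real"
    by (intro integrable_measure_pmf_finite finite_set_Pi_bernoulli) simp
  show ?case
    using split[where h = "testing_cost c (Test i T0 T1)"] i nin int
    by (simp add: testing_cost_upd T0 T1 algebra_simps del: testing_cost.simps)
       (simp add: testing_cost_upd algebra_simps)
next
  case (Output v)
  have "testing_cost c (Output v) = (\<lambda>_. 0)" by (simp add: fun_eq_iff)
  then show ?case by simp
qed

lemma expected_cost_eq_ecost:
  assumes "valid_instance I" "T \<in> strategies I"
  shows "expected_cost I T = ecost (prob I) (cost I) T"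
  unfolding expected_cost_def
  by (rule expectation_testing_cost[where f = "ltf I" and b = Map.empty])
     (use assms in \<open>auto simp: valid_instance_def strategies_def less_imp_le\<close>)

text \<open>The linearity behind the local ratio decomposition; for this reason \<open>ecost\<close>
  takes the cost vector as an argument instead of reading it from the instance.\<close>

lemma ecost_add_scaled: "ecost p (\<lambda>j. c j + y * r j) T = ecost p c T + y * ecost p r T"
  by (induction T) (auto simp: algebra_simps)

section \<open>Certificates of a threshold formula\<close>

definition need1 :: "ltf_instance \<Rightarrow> (nat \<rightharpoonup> bool) \<Rightarrow> int" where
  "need1 I b = threshold I -
     (\<Sum>i<dim I. case b i of None \<Rightarrow> min (coef I i) 0 | Some v \<Rightarrow> coef I i * of_bool v)"

text \<open>The \<open>+ 1\<close> uses integrality: staying below the threshold means staying at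
  most at the threshold minus 1.\<close>

definition need0 :: "ltf_instance \<Rightarrow> (nat \<rightharpoonup> bool) \<Rightarrow> int" where
  "need0 I b =
     (\<Sum>i<dim I. case b i of None \<Rightarrow> max (coef I i) 0 | Some v \<Rightarrow> coef I i * of_bool v) -
     threshold I + 1"

definition rem_coef :: "ltf_instance \<Rightarrow> (nat \<rightharpoonup> bool) \<Rightarrow> nat \<Rightarrow> int" where
  "rem_coef I b j = (if b j = None then coef I j else 0)"

lemma need1_le_0_iff: "need1 I b \<le> 0 \<longleftrightarrow> certificate (ltf I) b True"
proof
  assume *: "need1 I b \<le> 0"
  show "certificate (ltf I) b True"
    unfolding certificate_def
  proof (intro allI impI)
    fix x assume x: "\<forall>i w. b i = Some w \<longrightarrow> x i = w"
    have "(\<Sum>i<dim I. case b i of None \<Rightarrow> min (coef I i) 0 | Some v \<Rightarrow> coef I i * of_bool v)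
      \<le> (\<Sum>i<dim I. coef I i * of_bool (x i))"
      by (intro sum_mono) (use x in \<open>auto split: option.split\<close>)
    then show "ltf I x = True" using * by (simp add: ltf_def need1_def)
  qed
next
  assume *: "certificate (ltf I) b True"
  \<comment> \<open>The completion of \<open>b\<close> that minimizes the linear form; the
    certificate is applied to this worst case.\<close>
  define x where "x i = (case b i of None \<Rightarrow> coef I i < 0 | Some v \<Rightarrow> v)" for i
  have "ltf I x" using * by (auto simp: certificate_def x_def)
  moreover have "(\<Sum>i<dim I. case b i of None \<Rightarrow> min (coef I i) 0 | Some v \<Rightarrow> coef I i * of_bool v)
      = (\<Sum>i<dim I. coef I i * of_bool (x i))"
    by (intro sum.cong) (auto simp: x_def split: option.split)
  ultimately show "need1 I b \<le> 0" by (simp add: ltf_def need1_def)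
qed

lemma need0_le_0_iff: "need0 I b \<le> 0 \<longleftrightarrow> certificate (ltf I) b False"
proof
  assume *: "need0 I b \<le> 0"
  show "certificate (ltf I) b False"
    unfolding certificate_def
  proof (intro allI impI)
    fix x assume x: "\<forall>i w. b i = Some w \<longrightarrow> x i = w"
    have "(\<Sum>i<dim I. case b i of None \<Rightarrow> max (coef I i) 0 | Some v \<Rightarrow> coef I i * of_bool v)
      \<ge> (\<Sum>i<dim I. coef I i * of_bool (x i))"
      by (intro sum_mono) (use x in \<open>auto split: option.split\<close>)
    then show "ltf I x = False" using * by (simp add: ltf_def need0_def)
  qed
next
  assume *: "certificate (ltf I) b False"
  define x where "x i = (case b i of None \<Rightarrow> coef I i > 0 | Some v \<Rightarrow> v)" for i
  have "\<not> ltf I x" using * by (auto simp: certificate_def x_def)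
  moreover have "(\<Sum>i<dim I. case b i of None \<Rightarrow> max (coef I i) 0 | Some v \<Rightarrow> coef I i * of_bool v)
      = (\<Sum>i<dim I. coef I i * of_bool (x i))"
    by (intro sum.cong) (auto simp: x_def split: option.split)
  ultimately show "need0 I b \<le> 0" by (simp add: ltf_def need0_def)
qed

text \<open>Guarantees progress: in an open state both integers on the left are at least 1, so some
  untested variable has a nonzero coefficient.\<close>

lemma need_sum: "need0 I b + need1 I b = 1 + (\<Sum>i<dim I. \<bar>rem_coef I b i\<bar>)"
proof -
  have "(\<Sum>i<dim I. case b i of None \<Rightarrow> max (coef I i) 0 | Some v \<Rightarrow> coef I i * of_bool v) -
     (\<Sum>i<dim I. case b i of None \<Rightarrow> min (coef I i) 0 | Some v \<Rightarrow> coef I i * of_bool v)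
     = (\<Sum>i<dim I. \<bar>rem_coef I b i\<bar>)"
    unfolding sum_subtractf[symmetric]
    by (intro sum.cong) (auto simp: rem_coef_def split: option.split)
  then show ?thesis by (simp add: need0_def need1_def)
qed

lemma need1_upd:
  assumes "k < dim I" "b k = None"
  shows "need1 I (b(k \<mapsto> v)) = need1 I b - (if v \<longleftrightarrow> 0 < coef I k then \<bar>coef I k\<bar> else 0)"
  using assms unfolding need1_def by (simp add: sum.remove[of _ k])

lemma need0_upd:
  assumes "k < dim I" "b k = None"
  shows "need0 I (b(k \<mapsto> v)) = need0 I b - (if v \<longleftrightarrow> 0 < coef I k then 0 else \<bar>coef I k\<bar>)"
  using assms unfolding need0_def by (simp add: sum.remove[of _ k])

definition open_at :: "ltf_instance \<Rightarrow> (nat \<rightharpoonup> bool) \<Rightarrow> bool" where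
  "open_at I b \<longleftrightarrow> 0 < need1 I b \<and> 0 < need0 I b"

lemma open_at_iff: "open_at I b \<longleftrightarrow> \<not> certificate (ltf I) b False \<and> \<not> certificate (ltf I) b True"
  unfolding open_at_def need1_le_0_iff[symmetric] need0_le_0_iff[symmetric] by auto

section \<open>The gain of a test\<close>

text \<open>Which answer lowers \<open>need1\<close> depends on the sign of the coefficient. For
  coefficient 0 either choice gives expected gain 0 in an open state.\<close>

definition raise_prob :: "ltf_instance \<Rightarrow> nat \<Rightarrow> real" where
  "raise_prob I j = (if 0 < coef I j then prob I j else 1 - prob I j)"

definition gain1 :: "ltf_instance \<Rightarrow> (nat \<rightharpoonup> bool) \<Rightarrow> nat \<Rightarrow> int" where
  "gain1 I b j = min \<bar>rem_coef I b j\<bar> (need1 I b) * need0 I b"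

definition gain0 :: "ltf_instance \<Rightarrow> (nat \<rightharpoonup> bool) \<Rightarrow> nat \<Rightarrow> int" where
  "gain0 I b j = min \<bar>rem_coef I b j\<bar> (need0 I b) * need1 I b"

definition egain :: "ltf_instance \<Rightarrow> (nat \<rightharpoonup> bool) \<Rightarrow> nat \<Rightarrow> real" where
  "egain I b j = raise_prob I j * gain1 I b j + (1 - raise_prob I j) * gain0 I b j"

text \<open>Here \<open>g\<close> stands for the gain collected between \<open>b\<close> and
  \<open>b'\<close> and is compared with the drops of the two needs, each capped at its initial
  value. At a leaf one need is exhausted, so its capped drop alone contributes the full product, and
  the other term is nonnegative.\<close>

lemma ecost_egain_ge_aux:
  assumes "valid_instance I" "open_at I b"
    and "evaluates (ltf I) (dim I) b' T" "dom b \<subseteq> dom b'"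
    and "need1 I b' \<le> need1 I b" "need0 I b' \<le> need0 I b"
    and "g \<ge> need0 I b * min (need1 I b) (need1 I b - need1 I b') +
      need1 I b * min (need0 I b) (need0 I b - need0 I b')"
  shows "need1 I b * need0 I b \<le> g + ecost (prob I) (egain I b) T"
  using assms(3-)
proof (induction T arbitrary: b' g)
  case (Output v)
  have pos: "0 < need1 I b" "0 < need0 I b" using assms(2) by (auto simp: open_at_def)
  have "need1 I b' \<le> 0 \<or> need0 I b' \<le> 0"
    using Output by (cases v) (auto simp: need1_le_0_iff need0_le_0_iff)
  then have "need1 I b * need0 I b \<le> need0 I b * min (need1 I b) (need1 I b - need1 I b') +
      need1 I b * min (need0 I b) (need0 I b - need0 I b')"
  proof
    assume "need1 I b' \<le> 0"
    moreover have "0 \<le> need1 I b * min (need0 I b) (need0 I b - need0 I b')"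
      using pos Output by simp
    ultimately show ?thesis by (simp add: min_def mult.commute)
  next
    assume "need0 I b' \<le> 0"
    moreover have "0 \<le> need0 I b * min (need1 I b) (need1 I b - need1 I b')"
      using pos Output by simp
    ultimately show ?thesis by (simp add: min_def mult.commute)
  qed
  with Output(5) have "need1 I b * need0 I b \<le> g" by linarith
  then have "real_of_int (need1 I b * need0 I b) \<le> real_of_int g" by (rule of_int_le_iff[THEN iffD2])
  then show ?case by simp
next
  case (Test i T0 T1)
  let ?N1 = "need1 I b" and ?N0 = "need0 I b" and ?a = "\<bar>coef I i\<bar>"
  have pos: "0 < ?N1" "0 < ?N0" using assms(2) by (auto simp: open_at_def)
  have i: "i < dim I" "b' i = None" using Test.prems by auto
  then have bi: "b i = None" using Test.prems(2) by (auto simp: dom_def)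
  have p: "0 < prob I i" "prob I i < 1" using assms(1) i by (auto simp: valid_instance_def)
  define h where "h v = (if v \<longleftrightarrow> 0 < coef I i then gain1 I b i else gain0 I b i)" for v
  have eg: "egain I b i = (1 - prob I i) * h False + prob I i * h True"
    by (auto simp: egain_def raise_prob_def h_def gain1_def gain0_def rem_coef_def)
  have step: "need1 I b * need0 I b \<le> g + h v + ecost (prob I) (egain I b) (if v then T1 else T0)"
    for v
  proof -
    let ?b = "b'(i \<mapsto> v)"
    \<comment> \<open>Capping is subadditive, so capping each single step, as the gains do, collects
      at least as much as capping the total drop.\<close>
    have m: "min x (y + c) \<le> min x y + min c x" if "0 \<le> x" "0 \<le> c" "0 \<le> y" for x y c :: int
      using that by (auto simp: min_def)
    have "?N0 * min ?N1 (?N1 - need1 I ?b) + ?N1 * min ?N0 (?N0 - need0 I ?b)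
       \<le> ?N0 * min ?N1 (?N1 - need1 I b') + ?N1 * min ?N0 (?N0 - need0 I b') + h v"
    proof (cases "v \<longleftrightarrow> 0 < coef I i")
      case True
      have "min ?N1 (?N1 - need1 I b' + ?a) \<le> min ?N1 (?N1 - need1 I b') + min ?a ?N1"
        using pos Test.prems by (intro m) auto
      then have "?N0 * min ?N1 (?N1 - need1 I b' + ?a) \<le>
        ?N0 * (min ?N1 (?N1 - need1 I b') + min ?a ?N1)"
        using pos by (intro mult_left_mono) auto
      moreover have "?N1 - need1 I ?b = ?N1 - need1 I b' + ?a" "need0 I ?b = need0 I b'"
        "h v = ?N0 * min ?a ?N1"
        using True i bi by (simp_all add: need1_upd need0_upd h_def gain1_def rem_coef_def)
      ultimately show ?thesis by (simp only: distrib_left)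
    next
      case False
      have "min ?N0 (?N0 - need0 I b' + ?a) \<le> min ?N0 (?N0 - need0 I b') + min ?a ?N0"
        using pos Test.prems by (intro m) auto
      then have "?N1 * min ?N0 (?N0 - need0 I b' + ?a) \<le>
        ?N1 * (min ?N0 (?N0 - need0 I b') + min ?a ?N0)"
        using pos by (intro mult_left_mono) auto
      moreover have "?N0 - need0 I ?b = ?N0 - need0 I b' + ?a" "need1 I ?b = need1 I b'"
        using False i by (simp_all add: need1_upd need0_upd)
      moreover have "h v = ?N1 * min ?a ?N0"
        using False bi by (simp add: h_def gain0_def rem_coef_def)
      ultimately show ?thesis by (simp only: distrib_left)
    qed
    then have "g + h v \<ge> ?N0 * min ?N1 (?N1 - need1 I ?b) + ?N1 * min ?N0 (?N0 - need0 I ?b)"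
      using Test.prems(5) by linarith
    moreover have "dom b \<subseteq> dom ?b" "need1 I ?b \<le> need1 I b" "need0 I ?b \<le> need0 I b"
      using Test.prems i by (auto simp: need1_upd need0_upd)
    moreover have "evaluates (ltf I) (dim I) ?b (if v then T1 else T0)"
      using Test.prems by simp
    ultimately have "need1 I b * need0 I b \<le> (g + h v) + ecost (prob I) (egain I b) (if v then T1 else T0)"
      using Test.IH(1)[of ?b "g + h v"] Test.IH(2)[of ?b "g + h v"] by (metis (full_types))
    then show ?thesis by simp
  qed
  have "(1 - prob I i) * (need1 I b * need0 I b) \<le> (1 - prob I i) * (g + h False + ecost (prob I) (egain I b) T0)"
    using step[of False] p by (intro mult_left_mono) auto
  moreover have "prob I i * (need1 I b * need0 I b) \<le> prob I i * (g + h True + ecost (prob I) (egain I b) T1)"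
    using step[of True] p by (intro mult_left_mono) auto
  ultimately show ?case by (simp add: eg algebra_simps)
qed

text \<open>Unlike in the lower bound, \<open>g\<close> is compared with uncapped drops, which
  positivity of both needs controls in open states. At a leaf a need may lie far below 0 and this
  comparison no longer helps, so the last hypothesis carries the final estimate along
  separately.\<close>

lemma ecost_egain_le_aux:
  assumes "valid_instance I" "open_at I b"
    and "evaluates (ltf I) (dim I) b' T" "dom b \<subseteq> dom b'"
    and "g \<le> need0 I b * (need1 I b - need1 I b') + need1 I b * (need0 I b - need0 I b')"
    and "g \<le> 3 * (need1 I b * need0 I b)"
  shows "g + ecost (prob I) (egain I b) T \<le> 3 * (need1 I b * need0 I b)"
  using assms(3-)
proof (induction T arbitrary: b' g)
  case (Output v)
  then have "real_of_int g \<le> real_of_int (3 * (need1 I b * need0 I b))"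
    by (intro of_int_le_iff[THEN iffD2])
  then show ?case by simp
next
  case (Test i T0 T1)
  let ?N1 = "need1 I b" and ?N0 = "need0 I b" and ?a = "\<bar>coef I i\<bar>"
  have pos: "0 < ?N1" "0 < ?N0" using assms(2) by (auto simp: open_at_def)
  have i: "i < dim I" "b' i = None" using Test.prems by auto
  then have bi: "b i = None" using Test.prems(2) by (auto simp: dom_def)
  have p: "0 < prob I i" "prob I i < 1" using assms(1) i by (auto simp: valid_instance_def)
  have pos': "0 < need1 I b'" "0 < need0 I b'"
    using Test.prems(1) open_at_iff[of I b'] by (auto simp: open_at_def)
  define h where "h v = (if v \<longleftrightarrow> 0 < coef I i then gain1 I b i else gain0 I b i)" for v
  have eg: "egain I b i = (1 - prob I i) * h False + prob I i * h True"
    by (auto simp: egain_def raise_prob_def h_def gain1_def gain0_def rem_coef_def)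
  \<comment> \<open>A test is made only at an open \<open>b'\<close>, where each weighted drop is
    still below the product: two of the three units. The capped gain \<open>h v\<close> of the test
    at hand is the third.\<close>
  have g2: "g \<le> 2 * (?N1 * ?N0)"
  proof -
    have "?N0 * (?N1 - need1 I b') \<le> ?N0 * ?N1" "?N1 * (?N0 - need0 I b') \<le> ?N1 * ?N0"
      using pos pos' by (auto intro!: mult_left_mono)
    then show ?thesis using Test.prems(3) by (simp add: mult.commute)
  qed
  have step: "g + h v + ecost (prob I) (egain I b) (if v then T1 else T0) \<le> 3 * (need1 I b * need0 I b)"
    for v
  proof -
    let ?b = "b'(i \<mapsto> v)"
    have "h v \<le> ?N1 * ?N0"
      using pos by (auto simp: h_def gain1_def gain0_def mult.commute[of ?N1] intro!: mult_mono)
    with g2 have 1: "g + h v \<le> 3 * (?N1 * ?N0)" by linarith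
    have "min ?a ?N1 * ?N0 \<le> ?a * ?N0" "min ?a ?N0 * ?N1 \<le> ?a * ?N1"
      using pos by (auto intro!: mult_right_mono)
    then have "h v \<le> (if v \<longleftrightarrow> 0 < coef I i then ?a * ?N0 else ?a * ?N1)"
      using bi by (simp add: h_def gain1_def gain0_def rem_coef_def)
    then have 2: "g + h v \<le> ?N0 * (?N1 - need1 I ?b) + ?N1 * (?N0 - need0 I ?b)"
      using Test.prems(3) i by (auto simp: need1_upd need0_upd algebra_simps split: if_splits)
    have "dom b \<subseteq> dom ?b" using Test.prems by auto
    moreover have "evaluates (ltf I) (dim I) ?b (if v then T1 else T0)"
      using Test.prems by simp
    ultimately have "(g + h v) + ecost (prob I) (egain I b) (if v then T1 else T0) \<le> 3 * (need1 I b * need0 I b)"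
      using 1 2 Test.IH(1)[of ?b "g + h v"] Test.IH(2)[of ?b "g + h v"] by (metis (full_types))
    then show ?thesis by simp
  qed
  have "(1 - prob I i) * (g + h False + ecost (prob I) (egain I b) T0) \<le> (1 - prob I i) * (3 * (need1 I b * need0 I b))"
    using step[of False] p by (intro mult_left_mono) auto
  moreover have "prob I i * (g + h True + ecost (prob I) (egain I b) T1) \<le> prob I i * (3 * (need1 I b * need0 I b))"
    using step[of True] p by (intro mult_left_mono) auto
  ultimately show ?case by (simp add: eg algebra_simps)
qed

lemma ecost_egain_bounds:
  assumes "valid_instance I" "open_at I b" "evaluates (ltf I) (dim I) b T"
  shows "need1 I b * need0 I b \<le> ecost (prob I) (egain I b) T"
    and "ecost (prob I) (egain I b) T \<le> 3 * (need1 I b * need0 I b)"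
proof -
  have pos: "0 < need1 I b" "0 < need0 I b" using assms(2) by (auto simp: open_at_def)
  show "need1 I b * need0 I b \<le> ecost (prob I) (egain I b) T"
    using ecost_egain_ge_aux[OF assms(1,2,3), of 0] pos by simp
  show "ecost (prob I) (egain I b) T \<le> 3 * (need1 I b * need0 I b)"
    using ecost_egain_le_aux[OF assms(1,2,3), of 0] pos by simp
qed

section \<open>The greedy strategy\<close>

lemma certificate_upd:
  assumes "certificate f b v" "b k = None"
  shows "certificate f (b(k \<mapsto> w)) v"
  unfolding certificate_def
proof (intro allI impI)
  fix x assume x: "\<forall>i u. (b(k \<mapsto> w)) i = Some u \<longrightarrow> x i = u"
  have "x i = u" if "b i = Some u" for i u
    using x[rule_format, of i u] that assms(2) by (cases "i = k") auto
  then show "f x = v" using assms(1) unfolding certificate_def by blast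
qed

text \<open>Learning the value of \<open>k\<close> for free never hurts. This lets the optimum be
  compared with the two recursive calls of the greedy rule, whose residual cost at \<open>k\<close>
  is 0.\<close>

lemma evaluates_restrict:
  assumes "valid_instance I" "k < dim I"
    and "evaluates f (dim I) b T" "b k = None"
    and "\<And>j. j < dim I \<Longrightarrow> 0 \<le> d j"
  shows "\<exists>T0 T1. evaluates f (dim I) (b(k \<mapsto> False)) T0 \<and> evaluates f (dim I) (b(k \<mapsto> True)) T1 \<and>
    (1 - prob I k) * ecost (prob I) d T0 + prob I k * ecost (prob I) d T1 \<le> ecost (prob I) d T"
  using assms(3,4)
proof (induction T arbitrary: b)
  case (Output v)
  then show ?case by (intro exI[of _ "Output v"]) (simp add: certificate_upd[unfolded fun_upd_def])
next
  case (Test i T0 T1)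
  let ?p = "prob I" and ?E = "ecost (prob I) d"
  have i: "i < dim I" "b i = None" "0 \<le> d i" "0 < ?p i" "?p i < 1"
    using Test.prems assms(1,5) by (auto simp: valid_instance_def)
  have k: "0 < ?p k" "?p k < 1" using assms(1,2) by (auto simp: valid_instance_def)
  show ?case
  proof (cases "i = k")
    case True
    have "(1 - ?p k) * ?E T0 + ?p k * ?E T1 \<le> ?E (Test i T0 T1)" using i True by simp
    then show ?thesis using Test.prems(1) unfolding evaluates.simps True by blast
  next
    case False
    have ev: "evaluates f (dim I) (b(i \<mapsto> False)) T0" "evaluates f (dim I) (b(i \<mapsto> True)) T1"
      and nk: "(b(i \<mapsto> v)) k = None" for v
      using Test.prems False by simp_all
    obtain A0 A1 where A: "evaluates f (dim I) (b(i \<mapsto> False, k \<mapsto> False)) A0"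
      "evaluates f (dim I) (b(i \<mapsto> False, k \<mapsto> True)) A1"
      "(1 - ?p k) * ?E A0 + ?p k * ?E A1 \<le> ?E T0"
      using Test.IH(1)[OF ev(1) nk] by blast
    obtain B0 B1 where B: "evaluates f (dim I) (b(i \<mapsto> True, k \<mapsto> False)) B0"
      "evaluates f (dim I) (b(i \<mapsto> True, k \<mapsto> True)) B1"
      "(1 - ?p k) * ?E B0 + ?p k * ?E B1 \<le> ?E T1"
      using Test.IH(2)[OF ev(2) nk] by blast
    have nonneg: "0 \<le> ?E T" if "evaluates f (dim I) b' T" for T b'
      using that
    proof (induction T arbitrary: b')
      case (Test j S0 S1)
      then have "0 \<le> d j" "0 < ?p j" "?p j < 1" "0 \<le> ?E S0" "0 \<le> ?E S1"
        using assms(1,5) by (auto simp: valid_instance_def)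
      then show ?case by simp
    qed simp
    \<comment> \<open>The test of \<open>i\<close> is put back on top of the pieces belonging to one
      answer of \<open>k\<close>. If that answer already certifies the value, testing is forbidden
      and a leaf of cost 0 takes its place.\<close>
    have ex: "\<exists>T. evaluates f (dim I) (b(k \<mapsto> v)) T \<and>
        ?E T \<le> d i + (1 - ?p i) * ?E A + ?p i * ?E B"
      if "evaluates f (dim I) (b(i \<mapsto> False, k \<mapsto> v)) A" "evaluates f (dim I) (b(i \<mapsto> True, k \<mapsto> v)) B"
      for v A B
    proof (cases "\<exists>w. certificate f (b(k \<mapsto> v)) w")
      case True
      then obtain w where "certificate f (b(k \<mapsto> v)) w" by blast
      then show ?thesis using nonneg[OF that(1)] nonneg[OF that(2)] i
        by (intro exI[of _ "Output w"]) auto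
    next
      case no: False
      have "evaluates f (dim I) (b(k \<mapsto> v)) (Test i A B)"
        using no that i False by (simp add: fun_upd_twist)
      then show ?thesis by (intro exI[of _ "Test i A B"]) simp
    qed
    obtain S0 where S0: "evaluates f (dim I) (b(k \<mapsto> False)) S0"
        "?E S0 \<le> d i + (1 - ?p i) * ?E A0 + ?p i * ?E B0"
      using ex[OF A(1) B(1)] by auto
    obtain S1 where S1: "evaluates f (dim I) (b(k \<mapsto> True)) S1"
        "?E S1 \<le> d i + (1 - ?p i) * ?E A1 + ?p i * ?E B1"
      using ex[OF A(2) B(2)] by auto
    have "(1 - ?p k) * ?E S0 + ?p k * ?E S1 \<le>
       (1 - ?p k) * (d i + (1 - ?p i) * ?E A0 + ?p i * ?E B0) +
       ?p k * (d i + (1 - ?p i) * ?E A1 + ?p i * ?E B1)"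
      using S0 S1 k by (intro add_mono mult_left_mono) auto
    \<comment> \<open>The answers of \<open>i\<close> and \<open>k\<close> are independent, so the
      two averages may be exchanged.\<close>
    also have "\<dots> = d i + (1 - ?p i) * ((1 - ?p k) * ?E A0 + ?p k * ?E A1) +
        ?p i * ((1 - ?p k) * ?E B0 + ?p k * ?E B1)"
      by (simp add: algebra_simps)
    also have "\<dots> \<le> d i + (1 - ?p i) * ?E T0 + ?p i * ?E T1"
      using A(3) B(3) i by (intro add_mono mult_left_mono) auto
    finally show ?thesis using S0(1) S1(1) unfolding ecost.simps by blast
  qed
qed

text \<open>A left-to-right scan, so that it agrees step by step with the loop of the program,
  including the choice among ties. The start value 0 need not satisfy \<open>P\<close>, hence the
  test \<open>\<not> P k\<close>.\<close>

fun argmin_scan :: "(nat \<Rightarrow> bool) \<Rightarrow> (nat \<Rightarrow> real) \<Rightarrow> nat \<Rightarrow> nat" where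
  "argmin_scan P u 0 = 0"
| "argmin_scan P u (Suc j) =
     (let k = argmin_scan P u j in if P j \<and> (\<not> P k \<or> u j < u k) then j else k)"

lemma argmin_scan_le: "argmin_scan P u j \<le> j"
  by (induction j) (auto simp: Let_def)

lemma argmin_scan_minimal:
  assumes "i < n" "P i"
  shows "argmin_scan P u n < n" "P (argmin_scan P u n)" "u (argmin_scan P u n) \<le> u i"
proof -
  have "argmin_scan P u n < n \<and> P (argmin_scan P u n) \<and> u (argmin_scan P u n) \<le> u i"
    using assms
  proof (induction n arbitrary: i)
    case (Suc n)
    show ?case
    proof (cases "\<exists>i<n. P i")
      case True
      then obtain j where "j < n" "P j" by blast
      from Suc.IH[OF this]
      have *: "argmin_scan P u n < n" "P (argmin_scan P u n)" by auto
      show ?thesis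
      proof (cases "i = n")
        case True
        with * Suc.prems show ?thesis by (auto simp: Let_def)
      next
        case False
        with Suc.prems Suc.IH[of i] have "u (argmin_scan P u n) \<le> u i" by auto
        with * show ?thesis by (auto simp: Let_def)
      qed
    next
      case False
      then have "i = n" "P n" using Suc.prems less_SucE by blast+
      moreover have "argmin_scan P u n = n \<or> \<not> P (argmin_scan P u n)"
        using False argmin_scan_le[of P u n] by (auto simp: le_less)
      ultimately show ?thesis by (auto simp: Let_def)
    qed
  qed simp
  then show "argmin_scan P u n < n" "P (argmin_scan P u n)" "u (argmin_scan P u n) \<le> u i" by auto
qed

definition pick :: "ltf_instance \<Rightarrow> (nat \<rightharpoonup> bool) \<Rightarrow> (nat \<Rightarrow> real) \<Rightarrow> nat" where
  "pick I b d = argmin_scan (\<lambda>j. 0 < egain I b j) (\<lambda>j. d j / egain I b j) (dim I)"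

definition pay :: "ltf_instance \<Rightarrow> (nat \<rightharpoonup> bool) \<Rightarrow> (nat \<Rightarrow> real) \<Rightarrow> nat \<Rightarrow> real" where
  "pay I b d j = d j - d (pick I b d) / egain I b (pick I b d) * egain I b j"

lemma raise_prob_bounds:
  "valid_instance I \<Longrightarrow> j < dim I \<Longrightarrow> 0 < raise_prob I j \<and> raise_prob I j < 1"
  by (auto simp: raise_prob_def valid_instance_def)

lemma egain_nonneg:
  assumes "valid_instance I" "j < dim I" "open_at I b"
  shows "0 \<le> egain I b j"
  using raise_prob_bounds[OF assms(1,2)] assms(3)
  by (auto simp: egain_def gain0_def gain1_def open_at_def)

lemma egain_pos_iff:
  assumes "valid_instance I" "j < dim I" "open_at I b"
  shows "0 < egain I b j \<longleftrightarrow> rem_coef I b j \<noteq> 0"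
proof
  assume "rem_coef I b j \<noteq> 0"
  then have "0 < gain1 I b j" "0 < gain0 I b j"
    using assms(3) by (auto simp: gain0_def gain1_def open_at_def)
  then show "0 < egain I b j"
    using raise_prob_bounds[OF assms(1,2)] unfolding egain_def
    by (intro add_pos_pos mult_pos_pos) auto
qed (use assms(3) in \<open>auto simp: egain_def gain0_def gain1_def open_at_def\<close>)

lemma pick:
  assumes "valid_instance I" "open_at I b"
  shows "pick I b d < dim I" "0 < egain I b (pick I b d)" "b (pick I b d) = None"
    and "coef I (pick I b d) \<noteq> 0"
    and "\<And>j. j < dim I \<Longrightarrow> 0 < egain I b j \<Longrightarrow>
      d (pick I b d) / egain I b (pick I b d) \<le> d j / egain I b j"
proof -
  have "(\<Sum>i<dim I. \<bar>rem_coef I b i\<bar>) \<noteq> 0"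
    using need_sum[of I b] assms(2) by (auto simp: open_at_def)
  then obtain i where "i < dim I" "\<bar>rem_coef I b i\<bar> \<noteq> 0"
    by (metis (no_types, lifting) lessThan_iff sum.neutral)
  then have i: "i < dim I" "0 < egain I b i" using egain_pos_iff assms by auto
  note m = argmin_scan_minimal[where P = "\<lambda>j. 0 < egain I b j" and u = "\<lambda>j. d j / egain I b j"
      and n = "dim I", folded pick_def]
  show 1: "pick I b d < dim I" "0 < egain I b (pick I b d)" using m(1,2)[OF i] by auto
  then have "rem_coef I b (pick I b d) \<noteq> 0" using egain_pos_iff assms by blast
  then show "b (pick I b d) = None" "coef I (pick I b d) \<noteq> 0"
    by (auto simp: rem_coef_def split: if_splits)
  show "d (pick I b d) / egain I b (pick I b d) \<le> d j / egain I b j"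
    if "j < dim I" "0 < egain I b j" for j
    using m(3)[OF that] .
qed

text \<open>Minimality of the picked ratio is exactly nonnegativity of the residuals; a variable
  without gain keeps its cost. That residuals never grow later bounds their numerators.\<close>

lemma pay_bounds:
  assumes "valid_instance I" "open_at I b" "\<And>j. j < dim I \<Longrightarrow> 0 \<le> d j" "j < dim I"
  shows "0 \<le> pay I b d j" "pay I b d j \<le> d j"
proof -
  let ?k = "pick I b d"
  note pk = pick[OF assms(1,2), where d = d]
  have "0 \<le> d ?k / egain I b ?k" using assms(3) pk(1,2) by simp
  then show "pay I b d j \<le> d j" using egain_nonneg[OF assms(1,4,2)]
    unfolding pay_def by (smt (verit) mult_nonneg_nonneg)
  show "0 \<le> pay I b d j"
  proof (cases "0 < egain I b j")
    case True
    then show ?thesis using pk(5)[OF assms(4) True] by (simp add: pay_def pos_le_divide_eq)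
  next
    case False
    then have "egain I b j = 0" using egain_nonneg[OF assms(1,4,2)] by simp
    then show ?thesis using assms(3,4) by (simp add: pay_def)
  qed
qed

text \<open>A relation avoids a termination proof at definition time: that the picked variable is
  untested is known only for valid instances.\<close>

inductive greedy :: "ltf_instance \<Rightarrow> (nat \<rightharpoonup> bool) \<Rightarrow> (nat \<Rightarrow> real) \<Rightarrow> strategy \<Rightarrow> bool" for I where
  Output: "\<not> open_at I b \<Longrightarrow> greedy I b d (Output (need1 I b \<le> 0))"
| Test: "open_at I b \<Longrightarrow> k = pick I b d \<Longrightarrow> greedy I (b(k \<mapsto> False)) (pay I b d) T0 \<Longrightarrow>
    greedy I (b(k \<mapsto> True)) (pay I b d) T1 \<Longrightarrow> greedy I b d (Test k T0 T1)"

lemma greedy_exists: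
  assumes "valid_instance I"
  shows "\<exists>T. greedy I b d T"
proof (induction "card ({..<dim I} - dom b)" arbitrary: b d rule: less_induct)
  case less
  show ?case
  proof (cases "open_at I b")
    case True
    let ?k = "pick I b d"
    have "card ({..<dim I} - dom (b(?k \<mapsto> v))) < card ({..<dim I} - dom b)" for v
      using pick(1,3)[OF assms True, of d] by (intro psubset_card_mono) auto
    then have "\<exists>T. greedy I (b(?k \<mapsto> v)) (pay I b d) T" for v using less by simp
    then show ?thesis using greedy.Test[OF True refl] by metis
  qed (blast intro: greedy.Output)
qed

lemma greedy_evaluates:
  assumes "valid_instance I" "greedy I b d T"
  shows "evaluates (ltf I) (dim I) b T"
  using assms(2)
proof induction
  case (Output b d)
  then show ?case
    by (cases "need1 I b \<le> 0") (auto simp: need1_le_0_iff need0_le_0_iff open_at_iff)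
next
  case (Test b k d T0 T1)
  then show ?case using pick[OF assms(1) Test(1), where d = d] by (auto simp: open_at_iff fun_upd_def)
qed

text \<open>
  Local ratio: \<open>d\<close> splits into \<open>pay I b d\<close>, under which the picked test is free, and a multiple of
  \<open>egain I b\<close>, for which every strategy is \<open>3\<close>-approximate.
\<close>

lemma greedy_approx:
  assumes "valid_instance I" "greedy I b d T"
    and "\<And>j. j < dim I \<Longrightarrow> 0 \<le> d j" "evaluates (ltf I) (dim I) b T'"
  shows "ecost (prob I) d T \<le> 3 * ecost (prob I) d T'"
  using assms(2-)
proof (induction arbitrary: T')
  case (Output b d)
  \<comment> \<open>In a certified state \<open>T'\<close> may not test either, so both costs are
    0.\<close>
  then have "T' = Output (need1 I b \<le> 0) \<or> (\<exists>v. T' = Output v)"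
    by (cases T') (auto simp: open_at_iff)
  then show ?case by auto
next
  case (Test b k d T0 T1)
  let ?E = "ecost (prob I)" and ?d = "pay I b d"
  define y where "y = d k / egain I b k"
  have pk: "k < dim I" "0 < egain I b k" "b k = None"
    using pick[OF assms(1) Test.hyps(1), where d = d] Test.hyps(2) by auto
  have p: "0 < prob I k" "prob I k < 1" using assms(1) pk by (auto simp: valid_instance_def)
  have y: "0 \<le> y" unfolding y_def using pk Test.prems by simp
  have d: "d = (\<lambda>j. ?d j + y * egain I b j)" by (auto simp: pay_def y_def Test.hyps(2))
  have dk: "?d k = 0" using pk by (simp add: pay_def Test.hyps(2)[symmetric])
  have d': "\<And>j. j < dim I \<Longrightarrow> 0 \<le> ?d j"
    using pay_bounds[OF assms(1) Test.hyps(1)] Test.prems by blast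
  have "greedy I b d (Test k T0 T1)" using Test.hyps by (blast intro: greedy.Test)
  then have "ecost (prob I) (egain I b) (Test k T0 T1) \<le> 3 * (need1 I b * need0 I b)"
    using ecost_egain_bounds(2)[OF assms(1) Test.hyps(1)] greedy_evaluates[OF assms(1)] by blast
  also have "3 * (need1 I b * need0 I b) \<le> 3 * ?E (egain I b) T'"
    using ecost_egain_bounds(1)[OF assms(1) Test.hyps(1) Test.prems(2)] by simp
  finally have r: "?E (egain I b) (Test k T0 T1) \<le> 3 * ?E (egain I b) T'" .
  \<comment> \<open>The competitor is split along the variable picked by the greedy rule, even if it
    tests that variable late or never.\<close>
  obtain S0 S1 where S: "evaluates (ltf I) (dim I) (b(k \<mapsto> False)) S0"
    "evaluates (ltf I) (dim I) (b(k \<mapsto> True)) S1"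
    "(1 - prob I k) * ?E ?d S0 + prob I k * ?E ?d S1 \<le> ?E ?d T'"
    using evaluates_restrict[OF assms(1) pk(1) Test.prems(2) pk(3), of ?d] d' by blast
  have "?E ?d (Test k T0 T1) \<le> (1 - prob I k) * (3 * ?E ?d S0) + prob I k * (3 * ?E ?d S1)"
    using Test.IH(1)[OF d' S(1)] Test.IH(2)[OF d' S(2)] p dk
    by (auto intro!: add_mono mult_left_mono)
  also have "\<dots> \<le> 3 * ?E ?d T'" using S(3) by simp
  finally have "?E ?d (Test k T0 T1) \<le> 3 * ?E ?d T'" .
  moreover have "y * ?E (egain I b) (Test k T0 T1) \<le> y * (3 * ?E (egain I b) T')"
    using r y by (rule mult_left_mono)
  moreover have "?E d S = ?E ?d S + y * ?E (egain I b) S" for S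
    using ecost_add_scaled[of "prob I" ?d y "egain I b" S] unfolding d[symmetric] .
  ultimately show ?case by (simp del: ecost.simps)
qed

lemma greedy_cost_le_opt:
  assumes "valid_instance I" "greedy I Map.empty (cost I) T"
  shows "T \<in> strategies I" "expected_cost I T \<le> 3 * opt_cost I"
proof -
  show T: "T \<in> strategies I" using greedy_evaluates[OF assms] by (simp add: strategies_def)
  have "opt_cost I \<in> expected_cost I ` strategies I"
    unfolding opt_cost_def using finite_strategies strategies_nonempty by (intro Min_in) auto
  then obtain T' where T': "T' \<in> strategies I" "opt_cost I = expected_cost I T'" by blast
  have "ecost (prob I) (cost I) T \<le> 3 * ecost (prob I) (cost I) T'"
    using assms T' by (intro greedy_approx[OF assms]) (auto simp: valid_instance_def strategies_def)
  then show "expected_cost I T \<le> 3 * opt_cost I"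
    using T' T assms(1) by (simp add: expected_cost_eq_ecost)
qed

section \<open>Runs of the greedy rule and the size of their numbers\<close>

text \<open>The states of greedy runs under all possible answers. Bounds on the length of residual
  costs hold only along such runs, not for arbitrary \<open>d\<close>.\<close>

inductive reach :: "ltf_instance \<Rightarrow> (nat \<rightharpoonup> bool) \<Rightarrow> (nat \<Rightarrow> real) \<Rightarrow> bool" for I where
  start: "reach I Map.empty (cost I)"
| step: "reach I b d \<Longrightarrow> open_at I b \<Longrightarrow> reach I (b(pick I b d \<mapsto> v)) (pay I b d)"

lemma reach_dom:
  assumes "valid_instance I" "reach I b d"
  shows "dom b \<subseteq> {..<dim I}"
  using assms(2)
proof induction
  case (step b d v)
  have "dom (b(pick I b d \<mapsto> v)) \<subseteq> {..<dim I}"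
    using step pick(1)[OF assms(1) step(2), where d = d] by simp
  then show ?case .
qed simp

lemma reach_cost_bounds:
  assumes "valid_instance I" "reach I b d" "j < dim I"
  shows "0 \<le> d j \<and> d j \<le> cost I j"
  using assms(2,3)
proof (induction arbitrary: j)
  case start
  then show ?case using assms(1) by (auto simp: valid_instance_def)
next
  case (step b d v)
  then show ?case using pay_bounds[OF assms(1) step.hyps(2), of d j] by fastforce
qed

text \<open>One bound for all integers that the program stores: the needs with their partial sums,
  the coefficients, the counters, and by \<open>dim I + 2\<close> also the requests
  \<open>k + 2\<close> and the constants up to 2.\<close>

definition magnitude :: "ltf_instance \<Rightarrow> int" where
  "magnitude I = \<bar>threshold I\<bar> + (\<Sum>i<dim I. \<bar>coef I i\<bar>) + int (dim I) + 2"

lemma abs_rem_coef_le: "\<bar>rem_coef I b j\<bar> \<le> \<bar>coef I j\<bar>"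
  by (simp add: rem_coef_def)

lemma abs_coef_le_magnitude: "j < dim I \<Longrightarrow> \<bar>coef I j\<bar> \<le> magnitude I"
  using member_le_sum[of j "{..<dim I}" "\<lambda>i. \<bar>coef I i\<bar>"] by (simp add: magnitude_def)

lemma abs_need1_le: "\<bar>need1 I b\<bar> \<le> magnitude I"
proof -
  have "\<bar>\<Sum>i<dim I. case b i of None \<Rightarrow> min (coef I i) 0 | Some v \<Rightarrow> coef I i * of_bool v\<bar>
    \<le> (\<Sum>i<dim I. \<bar>coef I i\<bar>)"
    by (rule order_trans[OF sum_abs]) (auto intro!: sum_mono split: option.split)
  then show ?thesis by (simp add: need1_def magnitude_def)
qed

lemma abs_need0_le: "\<bar>need0 I b\<bar> \<le> magnitude I"
proof -
  have "\<bar>\<Sum>i<dim I. case b i of None \<Rightarrow> max (coef I i) 0 | Some v \<Rightarrow> coef I i * of_bool v\<bar>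
    \<le> (\<Sum>i<dim I. \<bar>coef I i\<bar>)"
    by (rule order_trans[OF sum_abs]) (auto intro!: sum_mono split: option.split)
  then show ?thesis by (simp add: need0_def magnitude_def)
qed

lemma egain_le:
  assumes "valid_instance I" "j < dim I" "open_at I b"
  shows "egain I b j \<le> real_of_int (magnitude I * magnitude I)"
proof -
  have pos: "0 < need1 I b" "0 < need0 I b" using assms(3) by (auto simp: open_at_def)
  let ?N = "magnitude I * magnitude I"
  have le: "need1 I b \<le> magnitude I" "need0 I b \<le> magnitude I"
    using abs_need1_le[of I b] abs_need0_le[of I b] by auto
  have "gain1 I b j \<le> ?N" "gain0 I b j \<le> ?N"
    unfolding gain1_def gain0_def using pos le by (auto intro!: mult_mono)
  then have g: "real_of_int (gain1 I b j) \<le> real_of_int ?N" "real_of_int (gain0 I b j) \<le> real_of_int ?N"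
    by (simp_all only: of_int_le_iff)
  have q: "0 < raise_prob I j" "raise_prob I j < 1" using raise_prob_bounds[OF assms(1,2)] by auto
  have "egain I b j \<le> raise_prob I j * real_of_int ?N + (1 - raise_prob I j) * real_of_int ?N"
    unfolding egain_def using g q by (intro add_mono mult_left_mono) auto
  then show ?thesis by (simp add: algebra_simps)
qed

section \<open>Fractions with bounded numerator and denominator\<close>

definition fits_bits :: "nat \<Rightarrow> real \<Rightarrow> bool" where
  "fits_bits e x \<longleftrightarrow> (\<exists>K M :: int. x = of_int K / of_int M \<and> 0 < M \<and> M \<le> 2 ^ e \<and> \<bar>K\<bar> \<le> 2 ^ e)"

lemma fits_bitsI: "x = of_int K / of_int M \<Longrightarrow> 0 < M \<Longrightarrow> M \<le> 2 ^ e \<Longrightarrow> \<bar>K\<bar> \<le> 2 ^ e \<Longrightarrow> fits_bits e x"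
  unfolding fits_bits_def by blast

lemma fits_bits_mono:
  assumes "fits_bits d x" "d \<le> e"
  shows "fits_bits e x"
proof -
  have "(2::int) ^ d \<le> 2 ^ e" using assms(2) by (intro power_increasing) auto
  then show ?thesis using assms(1) unfolding fits_bits_def by (blast intro: order_trans)
qed

lemma fits_bits_of_int: "\<bar>z\<bar> \<le> 2 ^ e \<Longrightarrow> fits_bits e (of_int z)"
  by (rule fits_bitsI[of _ z 1]) auto

lemma fits_bits_mult:
  assumes "fits_bits d x" "fits_bits e y"
  shows "fits_bits (d + e) (x * y)"
proof -
  from assms obtain K M K' M' :: int where
    *: "x = of_int K / of_int M" "0 < M" "M \<le> 2 ^ d" "\<bar>K\<bar> \<le> 2 ^ d"
       "y = of_int K' / of_int M'" "0 < M'" "M' \<le> 2 ^ e" "\<bar>K'\<bar> \<le> 2 ^ e"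
    unfolding fits_bits_def by blast
  show ?thesis
  proof (rule fits_bitsI)
    show "x * y = of_int (K * K') / of_int (M * M')" using * by simp
    show "0 < M * M'" using * by simp
    show "M * M' \<le> 2 ^ (d + e)" unfolding power_add using * by (intro mult_mono) auto
    show "\<bar>K * K'\<bar> \<le> 2 ^ (d + e)" unfolding power_add abs_mult using * by (intro mult_mono) auto
  qed
qed

lemma fits_bits_inverse:
  assumes "fits_bits e x"
  shows "fits_bits e (inverse x)"
proof -
  from assms obtain K M :: int where
    *: "x = of_int K / of_int M" "0 < M" "M \<le> 2 ^ e" "\<bar>K\<bar> \<le> 2 ^ e"
    unfolding fits_bits_def by blast
  consider "K = 0" | "0 < K" | "K < 0" by linarith
  then show ?thesis
  proof cases
    case 1
    then show ?thesis using * fits_bits_of_int[of 0 e] by simp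
  next
    case 2
    then show ?thesis using * by (intro fits_bitsI[of _ M K]) auto
  next
    case 3
    then show ?thesis using * by (intro fits_bitsI[of _ "- M" "- K"]) auto
  qed
qed

lemma fits_bits_divide: "fits_bits d x \<Longrightarrow> fits_bits e y \<Longrightarrow> fits_bits (d + e) (x / y)"
  unfolding divide_inverse by (intro fits_bits_mult fits_bits_inverse)

lemma fits_bits_add:
  assumes "fits_bits d x" "fits_bits e y"
  shows "fits_bits (d + e + 1) (x + y)"
proof -
  from assms obtain K M K' M' :: int where
    *: "x = of_int K / of_int M" "0 < M" "M \<le> 2 ^ d" "\<bar>K\<bar> \<le> 2 ^ d"
       "y = of_int K' / of_int M'" "0 < M'" "M' \<le> 2 ^ e" "\<bar>K'\<bar> \<le> 2 ^ e"
    unfolding fits_bits_def by blast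
  show ?thesis
  proof (rule fits_bitsI)
    show "x + y = of_int (K * M' + K' * M) / of_int (M * M')" using * by (simp add: field_simps)
    show "0 < M * M'" using * by simp
    have "M * M' \<le> 2 ^ d * 2 ^ e" using * by (intro mult_mono) auto
    also have "\<dots> \<le> 2 ^ (d + e + 1)" by (simp add: power_add)
    finally show "M * M' \<le> 2 ^ (d + e + 1)" .
    have "\<bar>K * M' + K' * M\<bar> \<le> \<bar>K\<bar> * M' + \<bar>K'\<bar> * M"
      using * abs_triangle_ineq[of "K * M'" "K' * M"] by (simp add: abs_mult)
    also have "\<dots> \<le> 2 ^ d * 2 ^ e + 2 ^ e * 2 ^ d"
      using * by (intro add_mono mult_mono) auto
    finally show "\<bar>K * M' + K' * M\<bar> \<le> 2 ^ (d + e + 1)" by (simp add: power_add)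
  qed
qed

lemma fits_bits_uminus: "fits_bits e x \<Longrightarrow> fits_bits e (- x)"
  unfolding fits_bits_def by (metis abs_minus_cancel minus_divide_left of_int_minus)

lemma fits_bits_diff: "fits_bits d x \<Longrightarrow> fits_bits e y \<Longrightarrow> fits_bits (d + e + 1) (x - y)"
  using fits_bits_add[OF _ fits_bits_uminus] by fastforce

text \<open>\<open>fits_bits\<close> admits unreduced fractions, so arithmetic needs no gcd.
  Reduction only shrinks numerator and denominator: each then has at most \<open>e + 1\<close> bits,
  and the weight adds 1.\<close>

lemma bit_weight_le:
  assumes "fits_bits e x"
  shows "bit_weight x \<le> 2 * e + 3"
proof -
  from assms obtain K M :: int where
    *: "x = of_int K / of_int M" "0 < M" "M \<le> 2 ^ e" "\<bar>K\<bar> \<le> 2 ^ e"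
    unfolding fits_bits_def by blast
  define q :: rat where "q = of_int K / of_int M"
  have "x = real_of_rat q" using * by (simp add: q_def of_rat_divide)
  then have inv: "inv real_of_rat x = q"
    by (metis inv_f_f injI of_rat_eq_iff)
  obtain k m where km: "quotient_of q = (k, m)" by fastforce
  have m: "0 < m" and cop: "coprime k m" and q: "q = of_int k / of_int m"
    using km quotient_of_denom_pos quotient_of_coprime quotient_of_div by blast+
  have "of_int K * of_int m = (of_int k * of_int M :: rat)"
    using q m * unfolding q_def by (simp add: field_simps)
  then have eq: "K * m = k * M" by (metis of_int_eq_iff of_int_mult)
  then have "m dvd k * M" by (metis dvd_triv_right)
  then have "m dvd M" using cop by (simp add: coprime_dvd_mult_right_iff coprime_commute)
  then obtain c where c: "M = m * c" by blast
  then have "0 < c" using * m by (metis zero_less_mult_pos)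
  have "m \<le> M" using \<open>m dvd M\<close> * by (auto intro: zdvd_imp_le)
  moreover have "K = k * c" using eq c m by (simp add: mult.assoc mult.left_commute)
  then have "\<bar>k\<bar> \<le> \<bar>K\<bar>" using \<open>0 < c\<close> mult_left_mono[of 1 c "\<bar>k\<bar>"] by (simp add: abs_mult)
  ultimately have le: "m \<le> 2 ^ e" "\<bar>k\<bar> \<le> 2 ^ e" using * by auto
  have "bitlen m \<le> int (e + 1)" "bitlen \<bar>k\<bar> \<le> int (e + 1)"
    using le unfolding bitlen_le_iff_power by (auto intro!: order.strict_trans1[OF le(1)] order.strict_trans1[OF le(2)])
  then show ?thesis unfolding bit_weight_def inv km by simp
qed

lemma fraction_of_bit_weight:
  assumes "x \<in> \<rat>"
  obtains k m :: int where "x = of_int k / of_int m" "0 < m" "m \<le> 2 ^ bit_weight x" "\<bar>k\<bar> \<le> 2 ^ bit_weight x"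
proof -
  obtain q where x: "x = real_of_rat q" using assms by (auto simp: Rats_def)
  then have inv: "inv real_of_rat x = q" by (metis inv_f_f injI of_rat_eq_iff)
  obtain k m where km: "quotient_of q = (k, m)" by fastforce
  have m: "0 < m" and q: "q = of_int k / of_int m"
    using km quotient_of_denom_pos quotient_of_div by blast+
  have w: "bit_weight x = nat (bitlen \<bar>k\<bar>) + nat (bitlen m) + 1"
    unfolding bit_weight_def inv km by simp
  have lt: "z < 2 ^ nat (bitlen z)" if "0 \<le> z" for z :: int
    using bitlen_bounds[of z] that by (cases "z = 0") auto
  have pw: "(2::int) ^ nat (bitlen m) \<le> 2 ^ bit_weight x" "(2::int) ^ nat (bitlen \<bar>k\<bar>) \<le> 2 ^ bit_weight x"
    by (intro power_increasing; simp add: w)+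
  have "x = of_int k / of_int m" unfolding x q by (simp add: of_rat_divide)
  moreover have "m \<le> 2 ^ bit_weight x" using lt[of m] m pw by linarith
  moreover have "\<bar>k\<bar> \<le> 2 ^ bit_weight x" using lt[of "\<bar>k\<bar>"] pw by linarith
  ultimately show ?thesis using m that by blast
qed

lemma abs_int_le_bit_weight: "\<bar>z\<bar> \<le> 2 ^ bit_weight (of_int z)"
proof -
  have "inv real_of_rat (real_of_int z) = of_int z"
    by (metis inv_f_f injI of_rat_eq_iff of_rat_of_int_eq)
  then have w: "bit_weight (of_int z) = nat (bitlen \<bar>z\<bar>) + nat (bitlen 1) + 1"
    unfolding bit_weight_def by simp
  have "\<bar>z\<bar> < 2 ^ nat (bitlen \<bar>z\<bar>)" using bitlen_bounds[of "\<bar>z\<bar>"] by (cases "z = 0") auto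
  also have "\<dots> \<le> 2 ^ bit_weight (of_int z)" by (intro power_increasing) (auto simp: w)
  finally show ?thesis by simp
qed

section \<open>Numbers of an instance in terms of its size\<close>

lemma dim_le_instance_size: "dim I \<le> instance_size w I"
proof -
  have "(\<Sum>i<dim I. 1) \<le> (\<Sum>i<dim I. w (of_int (coef I i)) + w (prob I i) + w (cost I i) + 1)"
    by (intro sum_mono) auto
  then show ?thesis by (simp add: instance_size_def)
qed

lemma weight_le_instance_size:
  "w (of_int (threshold I)) \<le> instance_size w I"
  "j < dim I \<Longrightarrow> w (of_int (coef I j)) \<le> instance_size w I"
  "j < dim I \<Longrightarrow> w (cost I j) \<le> instance_size w I"
proof -
  let ?f = "\<lambda>i. w (of_int (coef I i)) + w (prob I i) + w (cost I i) + 1"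
  have "?f j \<le> (\<Sum>i<dim I. ?f i)" if "j < dim I" using that by (intro member_le_sum) auto
  then show "w (of_int (threshold I)) \<le> instance_size w I"
    "j < dim I \<Longrightarrow> w (of_int (coef I j)) \<le> instance_size w I"
    "j < dim I \<Longrightarrow> w (cost I j) \<le> instance_size w I"
    by (auto simp: instance_size_def)
qed

lemma magnitude_le: "magnitude I \<le> 2 ^ (2 * instance_size bit_weight I + 3)"
proof -
  let ?L = "instance_size bit_weight I"
  have pw: "(2::int) ^ bit_weight x \<le> 2 ^ ?L" if "bit_weight x \<le> ?L" for x
    using that by (intro power_increasing) auto
  have th: "\<bar>threshold I\<bar> \<le> 2 ^ ?L"
    using abs_int_le_bit_weight[of "threshold I"] pw[OF weight_le_instance_size(1)] by linarith
  have "\<bar>coef I j\<bar> \<le> 2 ^ ?L" if "j < dim I" for j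
    using abs_int_le_bit_weight[of "coef I j"] pw[OF weight_le_instance_size(2)[OF that]] by linarith
  then have "(\<Sum>i<dim I. \<bar>coef I i\<bar>) \<le> of_nat (card {..<dim I}) * 2 ^ ?L"
    by (intro sum_bounded_above) auto
  then have s: "(\<Sum>i<dim I. \<bar>coef I i\<bar>) \<le> int (dim I) * 2 ^ ?L" by simp
  have n: "int (dim I) \<le> 2 ^ ?L"
    using dim_le_instance_size[of I bit_weight] of_nat_less_two_power[of ?L, where 'a = int] by linarith
  have "int (dim I) * 2 ^ ?L \<le> 2 ^ ?L * 2 ^ ?L" using n by (intro mult_right_mono) auto
  moreover have "(2::int) ^ ?L * 1 \<le> 2 ^ ?L * 2 ^ ?L" by (intro mult_left_mono) auto
  moreover have "(1::int) \<le> 2 ^ ?L" by simp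
  \<comment> \<open>Threshold, coefficient sum and dimension are each at most 4^L and the constant 2
    at most 2 * 4^L; the total factor 5 is rounded up to a power of two.\<close>
  ultimately have "magnitude I \<le> 8 * (2 ^ ?L * 2 ^ ?L)"
    using th s n unfolding magnitude_def by linarith
  also have "8 * (2 ^ ?L * 2 ^ ?L) = (2::int) ^ (2 * ?L + 3)"
    unfolding mult_2 power_add by simp
  finally show ?thesis .
qed

text \<open>The product of all denominators serves: its length is bounded by the sum of the weights
  of probabilities and costs, which is part of \<open>instance_size\<close>.\<close>

lemma common_denominator:
  assumes "rational_instance I"
  obtains D :: int where "0 < D" "D \<le> 2 ^ instance_size bit_weight I"
    "\<And>j. j < dim I \<Longrightarrow> \<exists>K::int. prob I j = of_int K / of_int D"
    "\<And>j. j < dim I \<Longrightarrow> \<exists>K::int. cost I j = of_int K / of_int D"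
proof -
  have "\<exists>m::int. 0 < m \<and> m \<le> 2 ^ bit_weight x \<and> (\<exists>k::int. x = of_int k / of_int m)" if "x \<in> \<rat>" for x
    using fraction_of_bit_weight[OF that] by metis
  then obtain den :: "real \<Rightarrow> int" where den:
    "\<And>x. x \<in> \<rat> \<Longrightarrow> 0 < den x \<and> den x \<le> 2 ^ bit_weight x \<and> (\<exists>k::int. x = of_int k / of_int (den x))"
    by metis
  have rat: "prob I j \<in> \<rat>" "cost I j \<in> \<rat>" if "j < dim I" for j
    using that assms by (auto simp: rational_instance_def)
  define D where "D = (\<Prod>j<dim I. den (prob I j) * den (cost I j))"
  have D: "0 < D" unfolding D_def using den rat by (intro prod_pos) auto
  have "D \<le> (\<Prod>j<dim I. 2 ^ (bit_weight (of_int (coef I j)) + bit_weight (prob I j) + bit_weight (cost I j) + 1))"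
    unfolding D_def
  proof (intro prod_mono conjI)
    fix j assume j: "j \<in> {..<dim I}"
    then have *: "0 < den (prob I j)" "den (prob I j) \<le> 2 ^ bit_weight (prob I j)"
      "0 < den (cost I j)" "den (cost I j) \<le> 2 ^ bit_weight (cost I j)" using den rat by auto
    then show "0 \<le> den (prob I j) * den (cost I j)" by simp
    have "den (prob I j) * den (cost I j) \<le> 2 ^ bit_weight (prob I j) * 2 ^ bit_weight (cost I j)"
      using * by (intro mult_mono) auto
    also have "\<dots> = 2 ^ (bit_weight (prob I j) + bit_weight (cost I j))" by (simp add: power_add)
    also have "\<dots> \<le> 2 ^ (bit_weight (of_int (coef I j)) + bit_weight (prob I j) + bit_weight (cost I j) + 1)"
      by (intro power_increasing) auto
    finally show "den (prob I j) * den (cost I j) \<le>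
      2 ^ (bit_weight (of_int (coef I j)) + bit_weight (prob I j) + bit_weight (cost I j) + 1)" .
  qed
  also have "\<dots> = 2 ^ (\<Sum>j<dim I. bit_weight (of_int (coef I j)) + bit_weight (prob I j) + bit_weight (cost I j) + 1)"
    by (rule power_sum[symmetric])
  also have "\<dots> \<le> 2 ^ instance_size bit_weight I"
    by (intro power_increasing) (auto simp: instance_size_def)
  finally have "D \<le> 2 ^ instance_size bit_weight I" .
  moreover have ext: "\<exists>K::int. x = of_int K / of_int D" if h: "x \<in> \<rat>" "den x dvd D" for x
  proof -
    obtain k :: int where k: "x = of_int k / of_int (den x)" and pos: "0 < den x" using den[OF h(1)] by blast
    obtain c where c: "D = den x * c" using h(2) by blast
    then have "0 < c" using D pos by (metis zero_less_mult_pos)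
    then have "x = of_int (k * c) / of_int D" using k pos by (subst k) (simp add: c)
    then show ?thesis by blast
  qed
  moreover have "den (prob I j) dvd D" "den (cost I j) dvd D" if "j < dim I" for j
  proof -
    have "den (prob I j) * den (cost I j) dvd D"
      unfolding D_def using that by (intro dvd_prodI) auto
    then show "den (prob I j) dvd D" "den (cost I j) dvd D"
      by (auto dest: dvd_mult_left dvd_mult_right)
  qed
  ultimately show ?thesis using that[of D] D rat by blast
qed

text \<open>An expected gain is affine in a single probability with integer coefficients, so the
  denominator \<open>D\<close> itself suffices. The numerator is bounded through the value, as
  \<open>D\<close> times \<open>egain\<close>.\<close>

lemma egain_fraction:
  assumes "valid_instance I" "open_at I b" "j < dim I" "0 < D" "prob I j = of_int K / of_int D"
  obtains G :: int where "egain I b j = of_int G / of_int D" "0 \<le> G" "G \<le> D * (magnitude I * magnitude I)"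
proof -
  define G where "G = (if 0 < coef I j then K * gain1 I b j + (D - K) * gain0 I b j
    else (D - K) * gain1 I b j + K * gain0 I b j)"
  have G: "egain I b j = of_int G / of_int D"
    using assms(4) by (simp add: egain_def raise_prob_def G_def assms(5) field_simps)
  have "real_of_int G = D * egain I b j" using G assms(4) by simp
  moreover have "0 \<le> D * egain I b j" using egain_nonneg[OF assms(1,3,2)] assms(4) by simp
  moreover have "D * egain I b j \<le> D * real_of_int (magnitude I * magnitude I)"
    using egain_le[OF assms(1,3,2)] assms(4) by (intro mult_left_mono) auto
  ultimately have "0 \<le> real_of_int G" "real_of_int G \<le> real_of_int (D * (magnitude I * magnitude I))"
    by simp_all
  then have "0 \<le> G" "G \<le> D * (magnitude I * magnitude I)" by (simp_all only: of_int_0_le_iff of_int_le_iff)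
  then show ?thesis using that G by blast
qed

text \<open>
  A round multiplies the common denominator of the residual costs only by the numerator of the
  gain of the picked variable, so it stays of polynomial length although the recursion for the
  residual costs is quadratic.
\<close>

lemma reach_denominator:
  assumes "valid_instance I" "reach I b d" "0 < D"
    and "\<And>j. j < dim I \<Longrightarrow> \<exists>K::int. prob I j = of_int K / of_int D"
    and "\<And>j. j < dim I \<Longrightarrow> \<exists>K::int. cost I j = of_int K / of_int D"
  shows "\<exists>M::int. 0 < M \<and> M \<le> D * (D * (magnitude I * magnitude I)) ^ card (dom b) \<and>
    (\<forall>j<dim I. \<exists>K::int. d j = of_int K / of_int M)"
  using assms(2)
proof induction
  case start
  then show ?case using assms(3,5) by (intro exI[of _ D]) auto
next
  case (step b d v)
  let ?k = "pick I b d" and ?X = "D * (magnitude I * magnitude I)"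
  note pk = pick[OF assms(1) step(2), where d = d]
  from step.IH obtain M :: int where M: "0 < M" "M \<le> D * ?X ^ card (dom b)"
    "\<And>j. j < dim I \<Longrightarrow> \<exists>K::int. d j = of_int K / of_int M" by blast
  have ex: "\<exists>G::int. egain I b j = of_int G / of_int D \<and> 0 \<le> G \<and> G \<le> ?X" if "j < dim I" for j
    using assms(4)[OF that] egain_fraction[OF assms(1) step(2) that assms(3)] by metis
  obtain G where G: "egain I b ?k = of_int G / of_int D" "0 \<le> G" "G \<le> ?X" using ex[OF pk(1)] by auto
  have G0: "0 < G" using G pk(2) assms(3) by (simp add: zero_less_divide_iff)
  obtain Kk where Kk: "d ?k = of_int Kk / of_int M" using M(3)[OF pk(1)] by blast
  have fr: "\<exists>K::int. pay I b d j = of_int K / of_int (M * G)" if j: "j < dim I" for j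
  proof -
    obtain Gj where Gj: "egain I b j = of_int Gj / of_int D" using ex[OF j] by auto
    obtain Kj where Kj: "d j = of_int Kj / of_int M" using M(3)[OF j] by blast
    \<comment> \<open>\<open>D\<close> cancels in the quotient of the two gains, and the two
      summands share the denominator \<open>M * G\<close>. This product does not depend on
      \<open>j\<close>.\<close>
    have "pay I b d j = of_int (Kj * G - Kk * Gj) / of_int (M * G)"
      unfolding pay_def G(1) Gj Kj Kk using M(1) G0 assms(3) by (simp add: field_simps)
    then show ?thesis by blast
  qed
  have fin: "finite (dom b)" using reach_dom[OF assms(1) step(1)] finite_subset by blast
  have "card (dom (b(?k \<mapsto> v))) = Suc (card (dom b))"
    using fin pk(3) by (simp add: domIff)
  moreover have "M * G \<le> (D * ?X ^ card (dom b)) * ?X"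
    using M G G0 by (intro mult_mono) (auto intro: order_trans[of 0 M])
  ultimately have "M * G \<le> D * ?X ^ card (dom (b(?k \<mapsto> v)))" by (simp only: power_Suc2 mult.assoc)
  moreover have "0 < M * G" using M(1) G0 by simp
  ultimately show ?case using fr by blast
qed

text \<open>Residual costs take 5 L^2 + 8 L bits, expected gains 5 L + 6, and their quotient the sum
  of both; the constant 7 leaves one bit of slack.\<close>

definition bit_level :: "nat \<Rightarrow> nat" where
  "bit_level L = 5 * L * L + 13 * L + 7"

lemma reach_fits_bits:
  assumes "valid_instance I" "rational_instance I"
  defines "E \<equiv> bit_level (instance_size bit_weight I)"
  shows "\<bar>z\<bar> \<le> magnitude I \<Longrightarrow> fits_bits E (of_int z)"
    and "j < dim I \<Longrightarrow> fits_bits E (prob I j)"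
    and "j < dim I \<Longrightarrow> fits_bits E (1 - prob I j)"
    and "reach I b d \<Longrightarrow> j < dim I \<Longrightarrow> fits_bits E (d j)"
    and "open_at I b \<Longrightarrow> j < dim I \<Longrightarrow> fits_bits E (egain I b j)"
    and "reach I b d \<Longrightarrow> open_at I b \<Longrightarrow> j < dim I \<Longrightarrow> fits_bits E (d j / egain I b j)"
proof -
  let ?L = "instance_size bit_weight I"
  obtain D :: int where D: "0 < D" "D \<le> 2 ^ ?L"
    "\<And>j. j < dim I \<Longrightarrow> \<exists>K::int. prob I j = of_int K / of_int D"
    "\<And>j. j < dim I \<Longrightarrow> \<exists>K::int. cost I j = of_int K / of_int D"
    using common_denominator[OF assms(2)] by blast
  let ?X = "D * (magnitude I * magnitude I)"
  have m: "magnitude I \<le> 2 ^ (2 * ?L + 3)" by (rule magnitude_le)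
  have m0: "0 \<le> magnitude I" by (simp add: magnitude_def sum_nonneg)
  have "?X \<le> 2 ^ ?L * (2 ^ (2 * ?L + 3) * 2 ^ (2 * ?L + 3))"
    using D m m0 by (intro mult_mono) auto
  also have "\<dots> = 2 ^ (?L + (2 * ?L + 3 + (2 * ?L + 3)))" by (simp only: power_add)
  also have "?L + (2 * ?L + 3 + (2 * ?L + 3)) = 5 * ?L + 6" by simp
  finally have X: "?X \<le> 2 ^ (5 * ?L + 6)" .
  have lin: "2 * ?L + 3 \<le> E" "?L \<le> E" "5 * ?L + 6 \<le> E" unfolding E_def bit_level_def by auto
  show "fits_bits E (of_int z)" if "\<bar>z\<bar> \<le> magnitude I"
    using fits_bits_mono[OF fits_bits_of_int lin(1)] m that by (meson order_trans)
  show "fits_bits E (prob I j)" "fits_bits E (1 - prob I j)" if h: "j < dim I"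
  proof -
    obtain K :: int where K: "prob I j = of_int K / of_int D" using D(3)[OF h] by blast
    have "0 < prob I j" "prob I j < 1" using assms(1) h by (auto simp: valid_instance_def)
    then have "0 < K" "K < D" using K D(1) by (auto simp: zero_less_divide_iff)
    then have "fits_bits ?L (prob I j)"
      using K D(1,2) by (intro fits_bitsI[of _ K D]) auto
    moreover have "fits_bits ?L (1 - prob I j)"
      using K D(1,2) \<open>0 < K\<close> \<open>K < D\<close> by (intro fits_bitsI[of _ "D - K" D]) (auto simp: field_simps)
    ultimately show "fits_bits E (prob I j)" "fits_bits E (1 - prob I j)" using fits_bits_mono lin(2) by blast+
  qed
  have eg: "fits_bits (5 * ?L + 6) (egain I b j)" if h: "open_at I b" "j < dim I"
  proof -
    obtain K :: int where K: "prob I j = of_int K / of_int D" using D(3)[OF h(2)] by blast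
    obtain G where "egain I b j = of_int G / of_int D" "0 \<le> G" "G \<le> ?X"
      using egain_fraction[OF assms(1) h D(1) K] by blast
    moreover have "D \<le> 2 ^ (5 * ?L + 6)" by (rule order_trans[OF D(2)], rule power_increasing) auto
    ultimately show ?thesis using D(1) X by (intro fits_bitsI[of _ G D]) auto
  qed
  then show "fits_bits E (egain I b j)" if "open_at I b" "j < dim I"
    using that fits_bits_mono lin(3) by blast
  \<comment> \<open>The inner sum is the length of the denominator: \<open>D\<close> and one gain
    numerator for each of at most L rounds. The numerator is value times denominator, and the value
    is at most the original cost, below 2^L; this adds the outer L.\<close>
  let ?F = "?L + (?L + (5 * ?L + 6) * ?L)"
  have dj: "fits_bits ?F (d j)" if r: "reach I b d" and j: "j < dim I"
  proof -
    obtain M :: int where M: "0 < M" "M \<le> D * ?X ^ card (dom b)"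
      "\<And>j. j < dim I \<Longrightarrow> \<exists>K::int. d j = of_int K / of_int M"
      using reach_denominator[OF assms(1) r D(1,3,4)] by blast
    have "card (dom b) \<le> dim I"
      using card_mono[OF _ reach_dom[OF assms(1) r]] by simp
    then have c: "card (dom b) \<le> ?L" using dim_le_instance_size[of I bit_weight] by linarith
    have "?X ^ card (dom b) \<le> (2 ^ (5 * ?L + 6)) ^ card (dom b)"
      using X D(1) m0 by (intro power_mono) auto
    also have "\<dots> \<le> (2 ^ (5 * ?L + 6)) ^ ?L"
      using c by (intro power_increasing) auto
    finally have "?X ^ card (dom b) \<le> 2 ^ ((5 * ?L + 6) * ?L)" by (simp only: power_mult)
    then have "D * ?X ^ card (dom b) \<le> 2 ^ ?L * 2 ^ ((5 * ?L + 6) * ?L)"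
      using D(1,2) m0 by (intro mult_mono) auto
    then have M2: "M \<le> 2 ^ (?L + (5 * ?L + 6) * ?L)" using M(2) by (simp add: power_add)
    obtain K :: int where K: "d j = of_int K / of_int M" using M(3)[OF j] by blast
    have "cost I j \<in> \<rat>" using assms(2) j by (simp add: rational_instance_def)
    then obtain k m :: int where km: "cost I j = of_int k / of_int m" "0 < m"
      "\<bar>k\<bar> \<le> 2 ^ bit_weight (cost I j)" using fraction_of_bit_weight by metis
    have "cost I j \<le> real_of_int \<bar>k\<bar>"
    proof -
      have "real_of_int k / real_of_int m \<le> real_of_int \<bar>k\<bar> / real_of_int m"
        using km(2) by (intro divide_right_mono) auto
      also have "\<dots> \<le> real_of_int \<bar>k\<bar> / 1" using km(2) by (intro divide_left_mono) auto
      finally show ?thesis using km(1) by simp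
    qed
    moreover have "\<bar>k\<bar> \<le> 2 ^ ?L"
      by (rule order_trans[OF km(3)], rule power_increasing[OF weight_le_instance_size(3)[OF j]]) simp
    then have "real_of_int \<bar>k\<bar> \<le> real_of_int (2 ^ ?L)" by (simp only: of_int_le_iff)
    ultimately have "cost I j \<le> real_of_int (2 ^ ?L)" by linarith
    then have d: "0 \<le> d j" "d j \<le> real_of_int (2 ^ ?L)"
      using reach_cost_bounds[OF assms(1) r j] by auto
    have "real_of_int K = d j * real_of_int M" using K M(1) by simp
    moreover have "0 \<le> d j * real_of_int M" using d M(1) by simp
    moreover have "d j * real_of_int M \<le> real_of_int (2 ^ ?L) * real_of_int M"
      using d M(1) by (intro mult_right_mono) auto
    ultimately have "0 \<le> real_of_int K" "real_of_int K \<le> real_of_int (2 ^ ?L * M)" by simp_all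
    then have "0 \<le> K" "K \<le> 2 ^ ?L * M" by (simp_all only: of_int_0_le_iff of_int_le_iff)
    moreover have "2 ^ ?L * M \<le> 2 ^ ?L * 2 ^ (?L + (5 * ?L + 6) * ?L)"
      using M2 by (intro mult_left_mono) auto
    ultimately have K2: "\<bar>K\<bar> \<le> 2 ^ ?F" unfolding power_add[of _ ?L "?L + (5 * ?L + 6) * ?L"] by linarith
    have "M \<le> 2 ^ ?F" by (rule order_trans[OF M2], rule power_increasing) auto
    then show ?thesis by (intro fits_bitsI[OF K M(1) _ K2])
  qed
  have F: "?F + (5 * ?L + 6) \<le> E" unfolding E_def bit_level_def by (simp add: algebra_simps)
  show "fits_bits E (d j)" if "reach I b d" "j < dim I"
    using fits_bits_mono[OF dj[OF that]] F by simp
  show "fits_bits E (d j / egain I b j)" if "reach I b d" "open_at I b" "j < dim I"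
    using fits_bits_mono[OF fits_bits_divide[OF dj eg] F] that by blast
qed

section \<open>Running time of programs\<close>

fun ileaves :: "iexp \<Rightarrow> nat" where
  "ileaves (IConst k) = 1"
| "ileaves (IVar x) = 1"
| "ileaves (IAdd d e) = ileaves d + ileaves e"
| "ileaves (ISub d e) = ileaves d + ileaves e"

text \<open>\<open>RNat\<close> and \<open>RArr\<close> count one extra because they charge a second
  weight on top of that of the address.\<close>

fun rleaves :: "rexp \<Rightarrow> nat" where
  "rleaves (RConst k) = 1"
| "rleaves (RNat e) = ileaves e + 1"
| "rleaves (RArr x e) = ileaves e + 1"
| "rleaves (RAdd d e) = rleaves d + rleaves e"
| "rleaves (RSub d e) = rleaves d + rleaves e"
| "rleaves (RMul d e) = rleaves d + rleaves e"
| "rleaves (RDiv d e) = rleaves d + rleaves e"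

fun bleaves :: "bexp \<Rightarrow> nat" where
  "bleaves (ILess d e) = ileaves d + ileaves e"
| "bleaves (RLess d e) = rleaves d + rleaves e"
| "bleaves (BNot d) = bleaves d + 1"
| "bleaves (BAnd d e) = bleaves d + bleaves e"

fun ifit :: "(real \<Rightarrow> bool) \<Rightarrow> state \<Rightarrow> iexp \<Rightarrow> bool" where
  "ifit F s (IConst k) = F (real k)"
| "ifit F s (IVar x) = F (real (nvar s x))"
| "ifit F s (IAdd d e) = (ifit F s d \<and> ifit F s e)"
| "ifit F s (ISub d e) = (ifit F s d \<and> ifit F s e)"

fun rfit :: "(real \<Rightarrow> bool) \<Rightarrow> state \<Rightarrow> rexp \<Rightarrow> bool" where
  "rfit F s (RConst k) = F (of_int k)"
| "rfit F s (RNat e) = ifit F s e"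
| "rfit F s (RArr x e) = (ifit F s e \<and> F (arr s x (ival e s)))"
| "rfit F s (RAdd d e) = (rfit F s d \<and> rfit F s e)"
| "rfit F s (RSub d e) = (rfit F s d \<and> rfit F s e)"
| "rfit F s (RMul d e) = (rfit F s d \<and> rfit F s e)"
| "rfit F s (RDiv d e) = (rfit F s d \<and> rfit F s e)"

fun bfit :: "(real \<Rightarrow> bool) \<Rightarrow> state \<Rightarrow> bexp \<Rightarrow> bool" where
  "bfit F s (ILess d e) = (ifit F s d \<and> ifit F s e)"
| "bfit F s (RLess d e) = (rfit F s d \<and> rfit F s e)"
| "bfit F s (BNot d) = bfit F s d"
| "bfit F s (BAnd d e) = (bfit F s d \<and> bfit F s e)"

lemma leaves_pos: "0 < ileaves d" "0 < rleaves e" "0 < bleaves c"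
proof -
  show i: "0 < ileaves d" for d by (induction d) auto
  show r: "0 < rleaves e" for e by (induction e) auto
  show "0 < bleaves c" by (induction c) (auto simp: i r)
qed

fun iconst :: "iexp \<Rightarrow> bool" where
  "iconst (IConst k) = (k \<le> 2)"
| "iconst (IVar x) = True"
| "iconst (IAdd d e) = (iconst d \<and> iconst e)"
| "iconst (ISub d e) = (iconst d \<and> iconst e)"

fun rconst :: "rexp \<Rightarrow> bool" where
  "rconst (RConst k) = (0 \<le> k \<and> k \<le> 2)"
| "rconst (RNat e) = iconst e"
| "rconst (RArr x e) = iconst e"
| "rconst (RAdd d e) = (rconst d \<and> rconst e)"
| "rconst (RSub d e) = (rconst d \<and> rconst e)"
| "rconst (RMul d e) = (rconst d \<and> rconst e)"
| "rconst (RDiv d e) = (rconst d \<and> rconst e)"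

fun bconst :: "bexp \<Rightarrow> bool" where
  "bconst (ILess d e) = (iconst d \<and> iconst e)"
| "bconst (RLess d e) = (rconst d \<and> rconst e)"
| "bconst (BNot d) = bconst d"
| "bconst (BAnd d e) = (bconst d \<and> bconst e)"

text \<open>The limit 20 covers every expression of the program; the longest, the guard that updates
  the minimum, counts 16.\<close>

definition ismall :: "iexp \<Rightarrow> bool" where
  "ismall e \<longleftrightarrow> iconst e \<and> ileaves e \<le> 20"

definition rsmall :: "rexp \<Rightarrow> bool" where
  "rsmall e \<longleftrightarrow> rconst e \<and> rleaves e \<le> 20"

definition bsmall :: "bexp \<Rightarrow> bool" where
  "bsmall e \<longleftrightarrow> bconst e \<and> bleaves e \<le> 20"

definition setN :: "vname \<Rightarrow> nat \<Rightarrow> state \<Rightarrow> state" where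
  "setN x v s = s\<lparr>nvar := (nvar s)(x := v)\<rparr>"

definition setA :: "vname \<Rightarrow> nat \<Rightarrow> real \<Rightarrow> state \<Rightarrow> state" where
  "setA x i v s = s\<lparr>arr := (arr s)(x := (arr s x)(i := v))\<rparr>"

lemma set_simps [simp]:
  "nvar (setN x v s) y = (if y = x then v else nvar s y)"
  "arr (setN x v s) = arr s"
  "nvar (setA x i r s) = nvar s"
  "arr (setA x i r s) y l = (if y = x \<and> l = i then r else arr s y l)"
  by (auto simp: setN_def setA_def)

text \<open>
  \<open>fits e x\<close> bounds the size of \<open>x\<close> by the level \<open>e\<close>: vacuous for the unit weight, and numerator and
  denominator at most \<open>2\<^sup>e\<close> for the bit weight.
\<close>

locale weight_bound =
  fixes w :: "real \<Rightarrow> nat" and fits :: "nat \<Rightarrow> real \<Rightarrow> bool"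
  assumes fits_mono: "fits d x \<Longrightarrow> d \<le> e \<Longrightarrow> fits e x"
    and fits_add: "fits d x \<Longrightarrow> fits e y \<Longrightarrow> fits (d + e + 1) (x + y)"
    and fits_diff: "fits d x \<Longrightarrow> fits e y \<Longrightarrow> fits (d + e + 1) (x - y)"
    and fits_mult: "fits d x \<Longrightarrow> fits e y \<Longrightarrow> fits (d + e + 1) (x * y)"
    and fits_divide: "fits d x \<Longrightarrow> fits e y \<Longrightarrow> fits (d + e + 1) (x / y)"
    and weight_le: "fits e x \<Longrightarrow> w x \<le> 2 * e + 3"
begin

text \<open>An expression with \<open>k\<close> leaves that fit into level \<open>E\<close> has values fitting into level
  \<open>k (E + 1) - 1\<close>; the quadratic form of the cost bounds absorbs the weights of all subexpressions.\<close>

lemma quadratic_step: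
  fixes m n :: nat
  assumes "a \<le> 5 * (E + 1) * (m * m)" "b \<le> 5 * (E + 1) * (n * n)" "0 < m" "0 < n"
    "c \<le> 2 * ((m + n) * (E + 1)) + 3"
  shows "a + b + c \<le> 5 * (E + 1) * ((m + n) * (m + n))"
proof -
  \<comment> \<open>The surplus 2 m n of (m + n)^2 over m^2 + n^2 pays for the weight of the newly
    computed value, which is linear in m + n.\<close>
  have "m + n \<le> 2 * (m * n)"
  proof -
    have "m \<le> m * n" "n \<le> m * n" using assms(3,4) by simp_all
    then show ?thesis by linarith
  qed
  then have "5 * (E + 1) * (m + n) \<le> 5 * (E + 1) * (2 * (m * n))" by (intro mult_le_mono) simp_all
  moreover have "2 \<le> m + n" using assms(3,4) by simp
  then have "(E + 1) * 2 \<le> (E + 1) * (m + n)" by (intro mult_le_mono) simp_all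
  ultimately have "2 * ((m + n) * (E + 1)) + 3 \<le> 5 * (E + 1) * (2 * (m * n))"
    by (simp add: algebra_simps)
  then show ?thesis using assms(1,2,5) by (simp add: algebra_simps)
qed

lemma level_step:
  fixes m n :: nat
  assumes "0 < m" "0 < n"
  shows "(m * (E + 1) - 1) + (n * (E + 1) - 1) + 1 = (m + n) * (E + 1) - 1"
proof -
  obtain m' n' where "m = Suc m'" "n = Suc n'" using assms gr0_implies_Suc by metis
  then show ?thesis by (simp add: algebra_simps)
qed

lemma weight_le_level: "fits (k * (E + 1) - 1) x \<Longrightarrow> w x \<le> 2 * (k * (E + 1)) + 3"
  using weight_le[of "k * (E + 1) - 1" x] by simp

lemma ifit_bounds:
  assumes "ifit (fits E) s e"
  shows "fits (ileaves e * (E + 1) - 1) (real (ival e s)) \<and>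
    icost w e s \<le> 5 * (E + 1) * (ileaves e * ileaves e)"
  using assms
proof (induction e)
  case (IConst k)
  then show ?case using weight_le[of E "real k"] by simp
next
  case (IVar x)
  then show ?case using weight_le[of E "real (nvar s x)"] by simp
next
  case (IAdd d e)
  then have f: "fits (ileaves (IAdd d e) * (E + 1) - 1) (real (ival (IAdd d e) s))"
    using fits_add[of "ileaves d * (E + 1) - 1" "real (ival d s)" "ileaves e * (E + 1) - 1" "real (ival e s)"]
    unfolding level_step[OF leaves_pos(1,1)] by simp
  have p: "ifit (fits E) s d" "ifit (fits E) s e" using IAdd.prems by simp_all
  show ?case
    using f quadratic_step[OF conjunct2[OF IAdd.IH(1)[OF p(1)]] conjunct2[OF IAdd.IH(2)[OF p(2)]]
      leaves_pos(1,1) weight_le_level[OF f[unfolded ileaves.simps]]]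
    unfolding icost.simps ileaves.simps by blast
next
  case (ISub d e)
  let ?d = "ileaves d * (E + 1) - 1" and ?e = "ileaves e * (E + 1) - 1"
  have "fits (?d + ?e + 1) (real (ival d s - ival e s))"
  proof (cases "ival e s \<le> ival d s")
    case True
    then show ?thesis using ISub fits_diff[of ?d "real (ival d s)" ?e "real (ival e s)"]
      by (simp add: of_nat_diff)
  next
    case False
    \<comment> \<open>Truncated subtraction gives 0, which the locale does not assume to fit. It is
      obtained as the difference of the operand of smaller level with itself.\<close>
    have "fits (?d + ?e + 1) (real (ival d s) - real (ival d s))"
      if "?d \<le> ?e" using ISub that fits_diff[of ?d "real (ival d s)" ?d "real (ival d s)"]
      by (auto intro: fits_mono)
    moreover have "fits (?d + ?e + 1) (real (ival e s) - real (ival e s))"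
      if "?e \<le> ?d" using ISub that fits_diff[of ?e "real (ival e s)" ?e "real (ival e s)"]
      by (auto intro: fits_mono)
    ultimately show ?thesis using False by (cases "?d \<le> ?e") auto
  qed
  then have f: "fits (ileaves (ISub d e) * (E + 1) - 1) (real (ival (ISub d e) s))"
    unfolding level_step[OF leaves_pos(1,1)] by simp
  have p: "ifit (fits E) s d" "ifit (fits E) s e" using ISub.prems by simp_all
  show ?case
    using f quadratic_step[OF conjunct2[OF ISub.IH(1)[OF p(1)]] conjunct2[OF ISub.IH(2)[OF p(2)]]
      leaves_pos(1,1) weight_le_level[OF f[unfolded ileaves.simps]]]
    unfolding icost.simps ileaves.simps by blast
qed

lemma quadratic_Suc:
  fixes k :: nat
  assumes "a \<le> 5 * (E + 1) * (k * k)" "c \<le> 2 * (k * (E + 1)) + 3"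
  shows "a + c \<le> 5 * (E + 1) * ((k + 1) * (k + 1))"
  using assms by (simp add: algebra_simps)

lemma rfit_bounds:
  assumes "rfit (fits E) s e"
  shows "fits (rleaves e * (E + 1) - 1) (rval e s) \<and>
    rcost w e s \<le> 5 * (E + 1) * (rleaves e * rleaves e)"
  using assms
proof (induction e)
  case (RConst k)
  then show ?case using weight_le[of E "of_int k"] by simp
next
  case (RNat e)
  then have f: "fits (ileaves e * (E + 1) - 1) (real (ival e s))"
    and c: "icost w e s \<le> 5 * (E + 1) * (ileaves e * ileaves e)" using ifit_bounds[of E s e] by auto
  have "fits (rleaves (RNat e) * (E + 1) - 1) (real (ival e s))"
    by (rule fits_mono[OF f]) simp
  then show ?case using quadratic_Suc[OF c weight_le_level[OF f]] by simp
next
  case (RArr x e)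
  then have f: "fits E (arr s x (ival e s))"
    and c: "icost w e s \<le> 5 * (E + 1) * (ileaves e * ileaves e)" using ifit_bounds[of E s e] by auto
  have 1: "fits (ileaves e * (E + 1) - 1) (arr s x (ival e s))"
    using leaves_pos(1)[of e] by (intro fits_mono[OF f]) (cases "ileaves e"; simp)
  have "fits (rleaves (RArr x e) * (E + 1) - 1) (arr s x (ival e s))"
    by (rule fits_mono[OF 1]) simp
  then show ?case using quadratic_Suc[OF c weight_le_level[OF 1]] by simp
next
  case (RAdd d e)
  then have f: "fits (rleaves (RAdd d e) * (E + 1) - 1) (rval (RAdd d e) s)"
    using fits_add[of "rleaves d * (E + 1) - 1" "rval d s" "rleaves e * (E + 1) - 1" "rval e s"]
    unfolding level_step[OF leaves_pos(2,2)] by simp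
  have p: "rfit (fits E) s d" "rfit (fits E) s e" using RAdd.prems by simp_all
  show ?case
    using f quadratic_step[OF conjunct2[OF RAdd.IH(1)[OF p(1)]] conjunct2[OF RAdd.IH(2)[OF p(2)]]
      leaves_pos(2,2) weight_le_level[OF f[unfolded rleaves.simps]]]
    unfolding rcost.simps rleaves.simps by blast
next
  case (RSub d e)
  then have f: "fits (rleaves (RSub d e) * (E + 1) - 1) (rval (RSub d e) s)"
    using fits_diff[of "rleaves d * (E + 1) - 1" "rval d s" "rleaves e * (E + 1) - 1" "rval e s"]
    unfolding level_step[OF leaves_pos(2,2)] by simp
  have p: "rfit (fits E) s d" "rfit (fits E) s e" using RSub.prems by simp_all
  show ?case
    using f quadratic_step[OF conjunct2[OF RSub.IH(1)[OF p(1)]] conjunct2[OF RSub.IH(2)[OF p(2)]]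
      leaves_pos(2,2) weight_le_level[OF f[unfolded rleaves.simps]]]
    unfolding rcost.simps rleaves.simps by blast
next
  case (RMul d e)
  then have f: "fits (rleaves (RMul d e) * (E + 1) - 1) (rval (RMul d e) s)"
    using fits_mult[of "rleaves d * (E + 1) - 1" "rval d s" "rleaves e * (E + 1) - 1" "rval e s"]
    unfolding level_step[OF leaves_pos(2,2)] by simp
  have p: "rfit (fits E) s d" "rfit (fits E) s e" using RMul.prems by simp_all
  show ?case
    using f quadratic_step[OF conjunct2[OF RMul.IH(1)[OF p(1)]] conjunct2[OF RMul.IH(2)[OF p(2)]]
      leaves_pos(2,2) weight_le_level[OF f[unfolded rleaves.simps]]]
    unfolding rcost.simps rleaves.simps by blast
next
  case (RDiv d e)
  then have f: "fits (rleaves (RDiv d e) * (E + 1) - 1) (rval (RDiv d e) s)"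
    using fits_divide[of "rleaves d * (E + 1) - 1" "rval d s" "rleaves e * (E + 1) - 1" "rval e s"]
    unfolding level_step[OF leaves_pos(2,2)] by simp
  have p: "rfit (fits E) s d" "rfit (fits E) s e" using RDiv.prems by simp_all
  show ?case
    using f quadratic_step[OF conjunct2[OF RDiv.IH(1)[OF p(1)]] conjunct2[OF RDiv.IH(2)[OF p(2)]]
      leaves_pos(2,2) weight_le_level[OF f[unfolded rleaves.simps]]]
    unfolding rcost.simps rleaves.simps by blast
qed

lemma bfit_bound:
  assumes "bfit (fits E) s e"
  shows "bcost w e s \<le> 5 * (E + 1) * (bleaves e * bleaves e)"
  using assms
proof (induction e)
  case (ILess d e)
  then show ?case
    using quadratic_step[of "icost w d s" E "ileaves d" "icost w e s" "ileaves e" 1]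
      ifit_bounds[of E s d] ifit_bounds[of E s e] leaves_pos(1)[of d] leaves_pos(1)[of e] by simp
next
  case (RLess d e)
  then show ?case
    using quadratic_step[of "rcost w d s" E "rleaves d" "rcost w e s" "rleaves e" 1]
      rfit_bounds[of E s d] rfit_bounds[of E s e] leaves_pos(2)[of d] leaves_pos(2)[of e] by simp
next
  case (BNot e)
  then show ?case using quadratic_Suc[of "bcost w e s" E "bleaves e" 1] by simp
next
  case (BAnd d e)
  then show ?case
    using quadratic_step[of "bcost w d s" E "bleaves d" "bcost w e s" "bleaves e" 1]
      leaves_pos(3)[of d] leaves_pos(3)[of e] by simp
qed

section \<open>Total correctness rules with time bounds\<close>

definition unit_time :: "nat \<Rightarrow> nat" where
  "unit_time E = 10000 * (E + 1)"

text \<open>Here 2000 = 5 * 20 * 20. An array assignment evaluates two expressions, so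
  \<open>unit_time\<close> bounds it with room to spare.\<close>

lemma leaves_le_20: "x \<le> 5 * (E + 1) * (k * k) \<Longrightarrow> k \<le> 20 \<Longrightarrow> x \<le> 2000 * (E + 1)" for k :: nat
proof -
  assume x: "x \<le> 5 * (E + 1) * (k * k)" and k: "k \<le> 20"
  have "k * k \<le> 20 * 20" using k by (intro mult_le_mono)
  then have "5 * (E + 1) * (k * k) \<le> 5 * (E + 1) * (20 * 20)" by (intro mult_le_mono2)
  then show ?thesis using x by simp
qed

text \<open>A precondition is replaced by a concrete start state, and the rest of a program sits in
  the postcondition, as in \<open>runs_Seq\<close>. Programs are thus executed symbolically through
  named states.\<close>

definition runs :: "com \<Rightarrow> state \<Rightarrow> nat \<Rightarrow> (state \<Rightarrow> bool) \<Rightarrow> bool" where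
  "runs P s K Q \<longleftrightarrow> (\<exists>t s'. exec w P s t s' \<and> t \<le> K \<and> Q s')"

lemma runs_mono:
  assumes "runs P s K Q" "K \<le> K'" "\<And>s. Q s \<Longrightarrow> Q' s"
  shows "runs P s K' Q'"
  using assms unfolding runs_def by (meson order_trans)

lemma runs_le: "runs P s K Q \<Longrightarrow> K \<le> K' \<Longrightarrow> runs P s K' Q"
  by (rule runs_mono)

lemma runs_Seq:
  assumes "runs P s K (\<lambda>s'. runs P' s' K' Q)"
  shows "runs (Seq P P') s (K + K') Q"
  using assms unfolding runs_def by (meson exec.Seq add_le_mono)

definition sfit :: "nat \<Rightarrow> state \<Rightarrow> bool" where
  "sfit E s \<longleftrightarrow> fits E 0 \<and> fits E 1 \<and> fits E 2 \<and>
     (\<forall>x. fits E (real (nvar s x))) \<and> (\<forall>x i. fits E (arr s x i))"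

lemma sfit_setN: "sfit E s \<Longrightarrow> fits E (real v) \<Longrightarrow> sfit E (setN x v s)"
  by (simp add: sfit_def)

lemma sfit_setA: "sfit E s \<Longrightarrow> fits E v \<Longrightarrow> sfit E (setA x i v s)"
  by (simp add: sfit_def)

lemma ifit_small:
  assumes "sfit E s" "iconst e"
  shows "ifit (fits E) s e"
  using assms(2)
proof (induction e)
  case (IConst k)
  then consider "k = 0" | "k = 1" | "k = 2" by fastforce
  then show ?case using assms(1) by cases (simp_all add: sfit_def)
qed (use assms(1) in \<open>simp_all add: sfit_def\<close>)

lemma rfit_small:
  assumes "sfit E s" "rconst e"
  shows "rfit (fits E) s e"
  using assms(2)
proof (induction e)
  case (RConst k)
  then consider "k = 0" | "k = 1" | "k = 2" by fastforce
  then show ?case using assms(1) by cases (simp_all add: sfit_def)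
qed (use assms(1) in \<open>simp_all add: ifit_small sfit_def\<close>)

lemma bfit_small:
  assumes "sfit E s" "bconst e"
  shows "bfit (fits E) s e"
  using assms(2) by (induction e) (use assms(1) in \<open>simp_all add: ifit_small rfit_small\<close>)

lemma small_costs:
  assumes "sfit E s"
  shows "ismall d \<Longrightarrow> icost w d s \<le> 2000 * (E + 1)"
    and "rsmall e \<Longrightarrow> rcost w e s \<le> 2000 * (E + 1)"
    and "bsmall c \<Longrightarrow> bcost w c s \<le> unit_time E"
proof -
  show "icost w d s \<le> 2000 * (E + 1)" if "ismall d"
    using that leaves_le_20 ifit_bounds[OF ifit_small[OF assms]] unfolding ismall_def by blast
  show "rcost w e s \<le> 2000 * (E + 1)" if "rsmall e"
    using that leaves_le_20 rfit_bounds[OF rfit_small[OF assms]] unfolding rsmall_def by blast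
  show "bcost w c s \<le> unit_time E" if c: "bsmall c"
  proof -
    have "bcost w c s \<le> 2000 * (E + 1)"
      using c leaves_le_20 bfit_bound[OF bfit_small[OF assms]] unfolding bsmall_def by blast
    then show ?thesis by (simp add: unit_time_def)
  qed
qed

text \<open>Successor state and value enter by equations, so that a named state with the intended
  mathematical value can be supplied and matched afterwards.\<close>

lemma runs_IAssign:
  assumes "Q s'" "s' = setN x v s" "sfit E s" "ismall e" "ival e s = v"
  shows "runs (IAssign x e) s (unit_time E) Q"
proof -
  have "icost w e s + 1 \<le> unit_time E"
    using small_costs(1)[OF assms(3,4)] by (simp add: unit_time_def)
  then show ?thesis unfolding runs_def using exec.IAssign assms(1,2,5) unfolding setN_def by blast
qed

lemma runs_RAssign:
  assumes "Q s'" "s' = setA x i v s" "sfit E s" "ismall d" "rsmall e" "ival d s = i" "rval e s = v"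
  shows "runs (RAssign x d e) s (unit_time E) Q"
proof -
  have "icost w d s + rcost w e s + 1 \<le> unit_time E"
    using small_costs(1)[OF assms(3,4)] small_costs(2)[OF assms(3,5)] by (simp add: unit_time_def)
  then show ?thesis unfolding runs_def using exec.RAssign assms(1,2,6,7) unfolding setA_def by blast
qed

lemma runs_Cond:
  assumes "sfit E s" "bsmall c" "bval c s \<Longrightarrow> runs P s K Q" "\<not> bval c s \<Longrightarrow> runs P' s K Q"
  shows "runs (Cond c P P') s (unit_time E + K) Q"
proof (cases "bval c s")
  case True
  then obtain t s' where "exec w P s t s'" "t \<le> K" "Q s'" using assms(3) unfolding runs_def by blast
  then show ?thesis
    unfolding runs_def using exec.CondTrue[OF True] small_costs(3)[OF assms(1,2)] add_le_mono by blast
next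
  case False
  then obtain t s' where "exec w P' s t s'" "t \<le> K" "Q s'" using assms(4) unfolding runs_def by blast
  then show ?thesis
    unfolding runs_def using exec.CondFalse[OF False] small_costs(3)[OF assms(1,2)] add_le_mono by blast
qed

lemma runs_RIf:
  assumes "Q s'" "s' = setA x i v s" "sfit E s" "bsmall c" "ismall d" "rsmall e" "rsmall e'"
    "ival d s = i" "(if bval c s then rval e s else rval e' s) = v"
  shows "runs (Cond c (RAssign x d e) (RAssign x d e')) s (2 * unit_time E) Q"
proof -
  have "runs (Cond c (RAssign x d e) (RAssign x d e')) s (unit_time E + unit_time E) Q"
    using assms by (intro runs_Cond runs_RAssign[OF _ assms(2)]) auto
  then show ?thesis by (simp add: mult_2)
qed

lemma runs_While_False:
  assumes "sfit E s" "bsmall c" "\<not> bval c s" "Q s"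
  shows "runs (While c P) s (unit_time E) Q"
  unfolding runs_def using exec.WhileFalse[OF assms(3)] assms(4) small_costs(3)[OF assms(1,2)] by blast

lemma runs_While_True:
  assumes "sfit E s" "bsmall c" "bval c s" "runs P s K (\<lambda>s'. runs (While c P) s' K' Q)"
  shows "runs (While c P) s (unit_time E + K + K') Q"
proof -
  obtain t s' u s'' where *: "exec w P s t s'" "t \<le> K" "exec w (While c P) s' u s''" "u \<le> K'" "Q s''"
    using assms(4) unfolding runs_def by blast
  have "exec w (While c P) s (bcost w c s + t + u) s''" using exec.WhileTrue[OF assms(3) *(1,3)] .
  moreover have "bcost w c s + t + u \<le> unit_time E + K + K'"
    using small_costs(3)[OF assms(1,2)] * by linarith
  ultimately show ?thesis unfolding runs_def using * by blast
qed

end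

abbreviation For :: "com \<Rightarrow> com" where
  "For P \<equiv> Seq (IAssign ''j'' (IConst 0))
     (While (ILess (IVar ''j'') (IVar ''n''))
       (Seq P (IAssign ''j'' (IAdd (IVar ''j'') (IConst 1)))))"

context weight_bound
begin

text \<open>The invariant is demanded after the pending increment of \<open>j\<close>, since the
  body itself must leave \<open>j\<close> and \<open>n\<close> unchanged.\<close>

lemma runs_For:
  assumes "sfit E s" "nvar s ''n'' = n" "Inv 0 (setN ''j'' 0 s)"
    and fit: "\<And>i. i \<le> n \<Longrightarrow> fits E (real i)"
    and step: "\<And>i s. i < n \<Longrightarrow> Inv i s \<Longrightarrow> sfit E s \<Longrightarrow> nvar s ''j'' = i \<Longrightarrow> nvar s ''n'' = n \<Longrightarrow>
      runs P s K (\<lambda>s'. Inv (Suc i) (setN ''j'' (Suc i) s') \<and>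
        sfit E s' \<and> nvar s' ''j'' = i \<and> nvar s' ''n'' = n)"
  shows "runs (For P) s (2 * unit_time E + n * (2 * unit_time E + K))
    (\<lambda>s'. Inv n s' \<and> sfit E s' \<and> nvar s' ''n'' = n)"
proof -
  let ?c = "ILess (IVar ''j'') (IVar ''n'')"
  let ?P = "Seq P (IAssign ''j'' (IAdd (IVar ''j'') (IConst 1)))"
  let ?Q = "\<lambda>s'. Inv n s' \<and> sfit E s' \<and> nvar s' ''n'' = n"
  have small: "bsmall ?c" "ismall (IAdd (IVar ''j'') (IConst 1))" "ismall (IConst 0)"
    by (simp_all add: bsmall_def ismall_def)
  have loop: "runs (While ?c ?P) s (unit_time E + (n - i) * (2 * unit_time E + K)) ?Q"
    if "i \<le> n" "Inv i s" "sfit E s" "nvar s ''j'' = i" "nvar s ''n'' = n" for i s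
    using that
  proof (induction "n - i" arbitrary: i s)
    case 0
    then show ?case
      by (intro runs_mono[OF runs_While_False[OF _ small(1), where E = E and Q = ?Q]]) auto
  next
    case (Suc m)
    then have i: "i < n" and m: "n - i = Suc m" by auto
    let ?K = "unit_time E + m * (2 * unit_time E + K)"
    have IH: "runs (While ?c ?P) s' ?K ?Q"
      if "Inv (Suc i) s'" "sfit E s'" "nvar s' ''j'' = Suc i" "nvar s' ''n'' = n" for s'
    proof -
      have "m = n - Suc i" using m by simp
      then show ?thesis using Suc.hyps(1)[of "Suc i" s'] i that by simp
    qed
    have "runs ?P s (K + unit_time E) (\<lambda>s'. runs (While ?c ?P) s' ?K ?Q)"
    proof (rule runs_Seq, rule runs_mono[OF step[OF i Suc.prems(2-5)] order_refl])
      fix s' assume s': "Inv (Suc i) (setN ''j'' (Suc i) s') \<and>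
        sfit E s' \<and> nvar s' ''j'' = i \<and> nvar s' ''n'' = n"
      show "runs (IAssign ''j'' (IAdd (IVar ''j'') (IConst 1))) s' (unit_time E)
        (\<lambda>s'. runs (While ?c ?P) s' ?K ?Q)"
      proof (rule runs_IAssign[OF _ refl _ small(2), where v = "Suc i"])
        show "runs (While ?c ?P) (setN ''j'' (Suc i) s') ?K ?Q"
          using s' i fit[of "Suc i"] by (intro IH sfit_setN) simp_all
      qed (use s' in simp_all)
    qed
    then have "runs (While ?c ?P) s (unit_time E + (K + unit_time E) + ?K) ?Q"
      using Suc.prems i by (intro runs_While_True[OF _ small(1)]) simp_all
    then show ?case unfolding m by (rule runs_le) simp
  qed
  have "runs (For P) s (unit_time E + (unit_time E + n * (2 * unit_time E + K))) ?Q"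
  proof (rule runs_Seq, rule runs_IAssign[OF _ refl _ small(3), where v = 0])
    show "runs (While ?c ?P) (setN ''j'' 0 s) (unit_time E + n * (2 * unit_time E + K)) ?Q"
      using loop[of 0 "setN ''j'' 0 s"] assms(1-3) sfit_setN[OF assms(1) fit[of 0], of "''j''"]
      by simp
  qed (use assms in simp_all)
  then show ?thesis by (rule runs_le) simp
qed

end

section \<open>The program\<close>

abbreviation RIf :: "bexp \<Rightarrow> vname \<Rightarrow> iexp \<Rightarrow> rexp \<Rightarrow> rexp \<Rightarrow> com" where
  "RIf c x i d e \<equiv> Cond c (RAssign x i d) (RAssign x i e)"

abbreviation "cell x \<equiv> RArr x (IConst 0)"

abbreviation "entry x i \<equiv> RArr x (IVar i)"

text \<open>\<open>R1\<close> and \<open>R0\<close> become the two needs of the empty assignment: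
  negative coefficients enter the first, the others the second.\<close>

definition init_prog :: com where
  "init_prog =
     Seq (RAssign ''R1'' (IConst 0) (cell ''theta''))
    (Seq (RAssign ''R0'' (IConst 0) (RSub (RConst 1) (cell ''theta'')))
    (For
      (Seq (RIf (RLess (entry ''a'' ''j'') (RConst 0)) ''R1'' (IConst 0)
              (RSub (cell ''R1'') (entry ''a'' ''j'')) (cell ''R1''))
           (RIf (RLess (entry ''a'' ''j'') (RConst 0)) ''R0'' (IConst 0)
              (cell ''R0'') (RAdd (cell ''R0'') (entry ''a'' ''j''))))))"

text \<open>\<open>h\<close> is the absolute coefficient, \<open>q\<close> the raising probability,
  \<open>u\<close> and \<open>v\<close> are the capped steps, \<open>r\<close> the expected gain.
  The last conditional is one step of \<open>argmin_scan\<close>, its disjunction written by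
  \<open>BNot\<close> and \<open>BAnd\<close>. Its quotients are evaluated even where a gain is 0;
  division is total.\<close>

definition gain_prog :: com where
  "gain_prog =
     Seq (RIf (RLess (RConst 0) (entry ''a'' ''j'')) ''h'' (IConst 0)
            (entry ''a'' ''j'') (RSub (RConst 0) (entry ''a'' ''j'')))
    (Seq (RIf (RLess (RConst 0) (entry ''a'' ''j'')) ''q'' (IConst 0)
            (entry ''p'' ''j'') (RSub (RConst 1) (entry ''p'' ''j'')))
    (Seq (RIf (RLess (cell ''h'') (cell ''R1'')) ''u'' (IConst 0) (cell ''h'') (cell ''R1''))
    (Seq (RIf (RLess (cell ''h'') (cell ''R0'')) ''v'' (IConst 0) (cell ''h'') (cell ''R0''))
    (Seq (RAssign ''r'' (IVar ''j'')
            (RAdd (RMul (cell ''q'') (RMul (cell ''u'') (cell ''R0'')))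
                  (RMul (RSub (RConst 1) (cell ''q'')) (RMul (cell ''v'') (cell ''R1'')))))
    (Cond (BAnd (RLess (RConst 0) (entry ''r'' ''j''))
             (BNot (BAnd (RLess (RConst 0) (entry ''r'' ''k''))
               (BNot (RLess (RDiv (entry ''c'' ''j'') (entry ''r'' ''j''))
                            (RDiv (entry ''c'' ''k'') (entry ''r'' ''k'')))))))
       (IAssign ''k'' (IVar ''j'')) (IAssign ''k'' (IVar ''k'')))))))"

text \<open>
  The entry of \<open>a\<close> is cleared once a variable has been tested, so that its gain becomes \<open>0\<close>. The
  number \<open>h\<close> is \<open>\<plusminus>\<bar>a\<^sub>k\<bar>\<close>, positive iff the answer brings a \<open>1\<close>-certificate closer.
\<close>

definition update_prog :: com where
  "update_prog =
     Seq (RAssign ''h'' (IConst 0)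
            (RMul (entry ''a'' ''k'') (RSub (RMul (RConst 2) (entry ''b'' ''k'')) (RConst 1))))
    (Seq (RIf (RLess (RConst 0) (cell ''h'')) ''R1'' (IConst 0)
            (RSub (cell ''R1'') (cell ''h'')) (cell ''R1''))
    (Seq (RIf (RLess (RConst 0) (cell ''h'')) ''R0'' (IConst 0)
            (cell ''R0'') (RAdd (cell ''R0'') (cell ''h'')))
    (RAssign ''a'' (IVar ''k'') (RConst 0))))"

text \<open>The ratio is saved in \<open>y\<close> because the second loop overwrites the cost of
  \<open>k\<close> itself. An entry of \<open>b\<close> above 1 is the code 2 of an unobserved
  variable.\<close>

definition round_prog :: com where
  "round_prog =
     Seq (IAssign ''k'' (IConst 0))
    (Seq (For gain_prog)
    (Seq (RAssign ''y'' (IConst 0) (RDiv (entry ''c'' ''k'') (entry ''r'' ''k'')))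
    (Seq (For (RAssign ''c'' (IVar ''j'')
            (RSub (entry ''c'' ''j'') (RMul (cell ''y'') (entry ''r'' ''j'')))))
    (Cond (RLess (RConst 1) (entry ''b'' ''k''))
       (IAssign ''result'' (IAdd (IVar ''k'') (IConst 2)))
       update_prog))))"

text \<open>\<open>result\<close> doubles as the loop flag: it stays 0 until a request, which is at
  least 2. If \<open>R1\<close> is positive at the end, the request or the output 0 is already in
  place.\<close>

definition greedy_prog :: com where
  "greedy_prog =
     Seq init_prog
    (Seq (While (BAnd (RLess (RConst 0) (cell ''R1''))
                (BAnd (RLess (RConst 0) (cell ''R0'')) (ILess (IVar ''result'') (IConst 1))))
            round_prog)
    (Cond (RLess (RConst 0) (cell ''R1''))
       (IAssign ''result'' (IVar ''result'')) (IAssign ''result'' (IConst 1))))"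

text \<open>
  The program is only given the observations \<open>b\<close>, so it recomputes the greedy run from the start and
  looks up the answers in \<open>b\<close>. The last two arguments bound the number of rounds and give the
  decision in the encoding of the variable \<open>result\<close>.
\<close>

inductive replay :: "ltf_instance \<Rightarrow> (nat \<rightharpoonup> bool) \<Rightarrow> (nat \<rightharpoonup> bool) \<Rightarrow> (nat \<Rightarrow> real) \<Rightarrow> nat \<Rightarrow> nat \<Rightarrow> bool"
  for I b where
  Done: "\<not> open_at I b' \<Longrightarrow> replay I b b' d 0 (of_bool (need1 I b' \<le> 0))"
| Ask: "open_at I b' \<Longrightarrow> b (pick I b' d) = None \<Longrightarrow> replay I b b' d 1 (pick I b' d + 2)"
| Known: "open_at I b' \<Longrightarrow> b (pick I b' d) = Some v \<Longrightarrow>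
    replay I b (b'(pick I b' d \<mapsto> v)) (pay I b' d) m u \<Longrightarrow> replay I b b' d (Suc m) u"

lemma replay_exists:
  assumes "valid_instance I"
  shows "\<exists>m u. replay I b b' d m u \<and> m \<le> card ({..<dim I} - dom b') + 1"
proof (induction "card ({..<dim I} - dom b')" arbitrary: b' d rule: less_induct)
  case less
  show ?case
  proof (cases "open_at I b'")
    case True
    let ?k = "pick I b' d"
    show ?thesis
    proof (cases "b ?k")
      case None
      then show ?thesis using replay.Ask[where b = b and d = d, OF True None] by (intro exI conjI) auto
    next
      case (Some v)
      have lt: "card ({..<dim I} - dom (b'(?k \<mapsto> v))) < card ({..<dim I} - dom b')"
        using pick(1,3)[OF assms True, where d = d] by (intro psubset_card_mono) auto
      obtain m u where "replay I b (b'(?k \<mapsto> v)) (pay I b' d) m u"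
        "m \<le> card ({..<dim I} - dom (b'(?k \<mapsto> v))) + 1"
        using less[OF lt] by blast
      then have "replay I b b' d (Suc m) u" "Suc m \<le> card ({..<dim I} - dom b') + 1"
        using replay.Known[where b = b and d = d, OF True Some] lt by auto
      then show ?thesis by blast
    qed
  next
    case False
    show ?thesis using replay.Done[OF False] by (intro exI conjI) auto
  qed
qed

text \<open>Rounds are prepended by going back along the run: all answers leading to
  \<open>b'\<close> are recorded in \<open>b\<close>, so the replay finds each of them
  known.\<close>

lemma replay_from_start:
  assumes "valid_instance I" "reach I b' d" "b' \<subseteq>\<^sub>m b" "replay I b b' d m u"
  shows "\<exists>m. replay I b Map.empty (cost I) m u"
  using assms(2-)
proof (induction arbitrary: m)
  case (step b' d v)
  let ?k = "pick I b' d"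
  have le: "b'(?k \<mapsto> v) \<subseteq>\<^sub>m b" and rp: "replay I b (b'(?k \<mapsto> v)) (pay I b' d) m u"
    using step.prems by blast+
  have k: "b' ?k = None" using pick(3)[OF assms(1) step.hyps(2)] .
  have "b ?k = Some v" using le by (metis domI fun_upd_same map_le_def)
  then have "replay I b b' d (Suc m) u" using replay.Known[OF step.hyps(2) _ rp] by blast
  moreover have "b' \<subseteq>\<^sub>m b" using le k by (auto simp: map_le_def dom_def split: if_splits) 
  ultimately show ?case using step.IH by blast
qed blast

lemmas small_defs = ismall_def rsmall_def bsmall_def

text \<open>Collects the numerical bounds that symbolic execution requires, so that one proof serves
  both weights.\<close>

locale greedy_machine = weight_bound +
  fixes I :: ltf_instance and E :: nat
  assumes valid: "valid_instance I"
    and fit_int: "\<bar>z\<bar> \<le> magnitude I \<Longrightarrow> fits E (of_int z)"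
    and fit_prob: "j < dim I \<Longrightarrow> fits E (prob I j)" "j < dim I \<Longrightarrow> fits E (1 - prob I j)"
    and fit_residual: "reach I b d \<Longrightarrow> j < dim I \<Longrightarrow> fits E (d j)"
    and fit_egain: "open_at I b \<Longrightarrow> j < dim I \<Longrightarrow> fits E (egain I b j)"
    and fit_ratio: "reach I b d \<Longrightarrow> open_at I b \<Longrightarrow> j < dim I \<Longrightarrow> fits E (d j / egain I b j)"
begin

section \<open>Correctness and running time of the program\<close>

abbreviation "n \<equiv> dim I"
abbreviation "U \<equiv> unit_time E"

lemma magnitude_ge: "int n + 2 \<le> magnitude I"
  by (simp add: magnitude_def sum_nonneg)

lemma fit_nat: "m \<le> n + 2 \<Longrightarrow> fits E (real m)"
  using fit_int[of "int m"] magnitude_ge by simp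

lemma fit_const: "fits E 0" "fits E 1" "fits E 2"
  using fit_nat[of 0] fit_nat[of 1] fit_nat[of 2] by simp_all

text \<open>\<open>b\<close> holds the observations given to the program, \<open>b'\<close> those
  already replayed.\<close>

definition rep :: "(nat \<rightharpoonup> bool) \<Rightarrow> (nat \<rightharpoonup> bool) \<Rightarrow> (nat \<Rightarrow> real) \<Rightarrow> state \<Rightarrow> bool" where
  "rep b b' d s \<longleftrightarrow> nvar s ''n'' = n \<and> nvar s ''result'' = 0 \<and>
     (\<forall>j<n. arr s ''a'' j = of_int (rem_coef I b' j) \<and> arr s ''c'' j = d j \<and>
       arr s ''p'' j = prob I j \<and>
       arr s ''b'' j = (case b j of None \<Rightarrow> 2 | Some v \<Rightarrow> of_bool v)) \<and>
     arr s ''R1'' 0 = of_int (need1 I b') \<and> arr s ''R0'' 0 = of_int (need0 I b')"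

lemma sfit_initial: "sfit E (initial_state I b)"
  unfolding sfit_def initial_state_def
  using fit_const fit_nat[of n] fit_prob fit_residual[OF reach.start] fit_int
    abs_coef_le_magnitude[of _ I]
  by (auto simp: magnitude_def sum_nonneg split: option.split)

lemma runs_init:
  "runs init_prog (initial_state I b) (4 * U + n * (6 * U))
     (\<lambda>s. sfit E s \<and> rep b Map.empty (cost I) s)"
proof -
  let ?lo = "\<lambda>i. threshold I - (\<Sum>l<i. min (coef I l) 0)"
  let ?hi = "\<lambda>i. 1 - threshold I + (\<Sum>l<i. max (coef I l) 0)"
  define Inv where "Inv i s \<longleftrightarrow> nvar s ''n'' = n \<and> nvar s ''result'' = 0 \<and>
     (\<forall>j<n. arr s ''a'' j = of_int (coef I j) \<and> arr s ''c'' j = cost I j \<and>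
       arr s ''p'' j = prob I j \<and>
       arr s ''b'' j = (case b j of None \<Rightarrow> 2 | Some v \<Rightarrow> of_bool v)) \<and>
     arr s ''R1'' 0 = of_int (?lo i) \<and> arr s ''R0'' 0 = of_int (?hi i)" for i and s :: state
  \<comment> \<open>Time is charged for intermediate values as well, so every partial sum must
    fit.\<close>
  have bnd: "\<bar>?lo i\<bar> \<le> magnitude I" "\<bar>?hi i\<bar> \<le> magnitude I" if "i \<le> n" for i
  proof -
    have "(\<Sum>l<i. \<bar>coef I l\<bar>) \<le> (\<Sum>l<n. \<bar>coef I l\<bar>)" using that by (intro sum_mono2) auto
    moreover have "\<bar>\<Sum>l<i. min (coef I l) 0\<bar> \<le> (\<Sum>l<i. \<bar>coef I l\<bar>)"
      "\<bar>\<Sum>l<i. max (coef I l) 0\<bar> \<le> (\<Sum>l<i. \<bar>coef I l\<bar>)"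
      by (rule order_trans[OF sum_abs], intro sum_mono, simp)+
    ultimately show "\<bar>?lo i\<bar> \<le> magnitude I" "\<bar>?hi i\<bar> \<le> magnitude I"
      unfolding magnitude_def by linarith+
  qed
  let ?A = "RIf (RLess (entry ''a'' ''j'') (RConst 0)) ''R1'' (IConst 0)
              (RSub (cell ''R1'') (entry ''a'' ''j'')) (cell ''R1'')"
  let ?B = "RIf (RLess (entry ''a'' ''j'') (RConst 0)) ''R0'' (IConst 0)
              (cell ''R0'') (RAdd (cell ''R0'') (entry ''a'' ''j''))"
  have step: "runs (Seq ?A ?B) s (2 * U + 2 * U) (\<lambda>s'. Inv (Suc i) (setN ''j'' (Suc i) s') \<and>
        sfit E s' \<and> nvar s' ''j'' = i \<and> nvar s' ''n'' = n)"
    (is "runs _ _ _ ?Q")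
    if i: "i < n" and s: "Inv i s" "sfit E s" "nvar s ''j'' = i" "nvar s ''n'' = n" for i s
  proof -
    have a: "arr s ''a'' i = of_int (coef I i)" "arr s ''R1'' 0 = of_int (?lo i)"
      "arr s ''R0'' 0 = of_int (?hi i)" using s i by (simp_all add: Inv_def)
    define s1 where "s1 = setA ''R1'' 0 (of_int (?lo (Suc i))) s"
    define s2 where "s2 = setA ''R0'' 0 (of_int (?hi (Suc i))) s1"
    have f: "fits E (of_int (?lo (Suc i)))" "fits E (of_int (?hi (Suc i)))"
      by (rule fit_int, rule bnd, use i in simp)+
    have s1: "sfit E s1" unfolding s1_def by (rule sfit_setA[OF s(2) f(1)])
    have s2: "sfit E s2" unfolding s2_def by (rule sfit_setA[OF s1 f(2)])
    have "Inv (Suc i) (setN ''j'' (Suc i) s2)"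
      using s(1) unfolding Inv_def s2_def s1_def by simp
    then have "?Q s2" using s2 s(3,4) by (simp add: s2_def s1_def)
    then have "runs ?B s1 (2 * U) ?Q"
      by (rule runs_RIf[OF _ s2_def s1]) (use a s(3) in \<open>auto simp: small_defs s1_def\<close>)
    then show ?thesis
      by (intro runs_Seq, elim runs_RIf[OF _ s1_def s(2)]) (use a s(3) in \<open>auto simp: small_defs\<close>)
  qed
  define s1 where "s1 = setA ''R1'' 0 (of_int (threshold I)) (initial_state I b)"
  define s2 where "s2 = setA ''R0'' 0 (of_int (1 - threshold I)) s1"
  have f: "fits E (of_int (threshold I))" "fits E (of_int (1 - threshold I))"
    using bnd[of 0] fit_int[of "threshold I"] fit_int[of "1 - threshold I"] by simp_all
  have s1: "sfit E s1" unfolding s1_def by (rule sfit_setA[OF sfit_initial f(1)])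
  have s2: "sfit E s2" unfolding s2_def by (rule sfit_setA[OF s1 f(2)])
  have inv0: "Inv 0 (setN ''j'' 0 s2)" and n2: "nvar s2 ''n'' = n"
    by (auto simp: Inv_def s2_def s1_def initial_state_def)
  have fin: "rep b Map.empty (cost I) s" if "Inv n s" for s
    using that by (simp add: Inv_def rep_def rem_coef_def need1_def need0_def)
  have "runs (For (Seq ?A ?B)) s2 (2 * U + n * (2 * U + (2 * U + 2 * U)))
     (\<lambda>s. Inv n s \<and> sfit E s \<and> nvar s ''n'' = n)"
    by (rule runs_For[OF s2 n2 inv0 _ step]) (simp_all add: fit_nat)
  then have "runs (For (Seq ?A ?B)) s2 (2 * U + n * (6 * U))
     (\<lambda>s. sfit E s \<and> rep b Map.empty (cost I) s)"
    by (rule runs_mono) (use fin in simp_all)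
  then have "runs (Seq (RAssign ''R0'' (IConst 0) (RSub (RConst 1) (cell ''theta''))) (For (Seq ?A ?B)))
     s1 (U + (2 * U + n * (6 * U))) (\<lambda>s. sfit E s \<and> rep b Map.empty (cost I) s)"
    by (intro runs_Seq, elim runs_RAssign[OF _ s2_def s1])
      (simp_all add: small_defs s1_def initial_state_def)
  then have "runs init_prog (initial_state I b) (U + (U + (2 * U + n * (6 * U))))
     (\<lambda>s. sfit E s \<and> rep b Map.empty (cost I) s)"
    unfolding init_prog_def by (intro runs_Seq, elim runs_RAssign[OF _ s1_def sfit_initial])
      (simp_all add: small_defs initial_state_def)
  then show ?thesis by (rule runs_le) simp
qed

abbreviation "live b j \<equiv> 0 < egain I b j"
abbreviation "ratio b d j \<equiv> d j / egain I b j"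

definition gain_inv where
  "gain_inv b b' d i s \<longleftrightarrow> rep b b' d s \<and> (\<forall>l<i. arr s ''r'' l = egain I b' l) \<and>
     nvar s ''k'' = argmin_scan (live b') (ratio b' d) i"

lemma runs_gain:
  assumes op: "open_at I b'"
    and i: "i < n" and s: "gain_inv b b' d i s" "sfit E s" "nvar s ''j'' = i" "nvar s ''n'' = n"
  shows "runs gain_prog s (11 * U) (\<lambda>s'. gain_inv b b' d (Suc i) (setN ''j'' (Suc i) s') \<and>
    sfit E s' \<and> nvar s' ''j'' = i \<and> nvar s' ''n'' = n)"
    (is "runs _ _ _ ?Q")
proof -
  let ?a = "rem_coef I b' i" and ?N1 = "need1 I b'" and ?N0 = "need0 I b'"
  define h where "h = \<bar>?a\<bar>"
  define u where "u = min h ?N1"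
  define v where "v = min h ?N0"
  define q where "q = (if 0 < ?a then prob I i else 1 - prob I i)"
  define k where "k = argmin_scan (live b') (ratio b' d) i"
  define k' where "k' = argmin_scan (live b') (ratio b' d) (Suc i)"
  have N: "0 < ?N1" "0 < ?N0" using op by (auto simp: open_at_def)
  have val: "arr s ''a'' i = of_int ?a" "arr s ''p'' i = prob I i" "arr s ''R1'' 0 = of_int ?N1"
    "arr s ''R0'' 0 = of_int ?N0" "\<And>l. l < n \<Longrightarrow> arr s ''c'' l = d l"
    "\<And>l. l < i \<Longrightarrow> arr s ''r'' l = egain I b' l" "nvar s ''k'' = k"
    using s i by (auto simp: gain_inv_def rep_def k_def)
  \<comment> \<open>For a replayed variable the program sees coefficient 0, and \<open>q\<close> may
    differ from \<open>raise_prob\<close>; both capped steps are then 0.\<close>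
  have eg: "q * (of_int u * of_int ?N0) + (1 - q) * (of_int v * of_int ?N1)
      = egain I b' i"
  proof (cases "?a = 0")
    case True
    then show ?thesis using N by (simp add: egain_def gain1_def gain0_def h_def u_def v_def)
  next
    case False
    then have "q = raise_prob I i" by (auto simp: q_def raise_prob_def rem_coef_def split: if_splits)
    then show ?thesis by (simp only: egain_def gain1_def gain0_def of_int_mult h_def u_def v_def)
  qed
  have a: "h \<le> magnitude I" "0 \<le> h" unfolding h_def 
    using abs_rem_coef_le[of I b' i] abs_coef_le_magnitude[OF i] by linarith+
  have uv: "\<bar>u\<bar> \<le> magnitude I" "\<bar>v\<bar> \<le> magnitude I" using a N by (auto simp: u_def v_def min_def)
  have min: "(if real_of_int x < of_int y then real_of_int x else of_int y) = of_int (min x y)" for x y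
    by (simp add: min_def)
  have kle: "k \<le> i" "k' \<le> Suc i" unfolding k_def k'_def by (rule argmin_scan_le)+
  have f: "fits E (of_int h)" "fits E q" "fits E (of_int u)"
    "fits E (of_int v)" "fits E (egain I b' i)" "fits E (real k')"
    using a uv i fit_prob[OF i] fit_egain[OF op i] fit_nat[of k'] kle
      fit_int[of h] fit_int[of u] fit_int[of v]
    by (simp_all add: q_def)
  define s1 where "s1 = setA ''h'' 0 (of_int h) s"
  define s2 where "s2 = setA ''q'' 0 q s1"
  define s3 where "s3 = setA ''u'' 0 (of_int u) s2"
  define s4 where "s4 = setA ''v'' 0 (of_int v) s3"
  define s5 where "s5 = setA ''r'' i (egain I b' i) s4"
  define s6 where "s6 = setN ''k'' k' s5"
  have s1: "sfit E s1" unfolding s1_def by (rule sfit_setA[OF s(2) f(1)])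
  have s2: "sfit E s2" unfolding s2_def by (rule sfit_setA[OF s1 f(2)])
  have s3: "sfit E s3" unfolding s3_def by (rule sfit_setA[OF s2 f(3)])
  have s4: "sfit E s4" unfolding s4_def by (rule sfit_setA[OF s3 f(4)])
  have s5: "sfit E s5" unfolding s5_def by (rule sfit_setA[OF s4 f(5)])
  have s6: "sfit E s6" unfolding s6_def by (rule sfit_setN[OF s5 f(6)])
  note defs = s1_def s2_def s3_def s4_def s5_def s6_def
  have "rep b b' d (setN ''j'' (Suc i) s6)"
    using s(1) by (simp add: gain_inv_def rep_def defs)
  moreover have "arr (setN ''j'' (Suc i) s6) ''r'' l = egain I b' l" if "l < Suc i" for l
    using that val(6)[of l] by (auto simp: defs)
  ultimately have "gain_inv b b' d (Suc i) (setN ''j'' (Suc i) s6)"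
    by (simp add: gain_inv_def s6_def k'_def)
  then have Q: "?Q s6" using s6 s(3,4) by (simp add: defs)
  let ?c = "BAnd (RLess (RConst 0) (entry ''r'' ''j''))
             (BNot (BAnd (RLess (RConst 0) (entry ''r'' ''k''))
               (BNot (RLess (RDiv (entry ''c'' ''j'') (entry ''r'' ''j''))
                            (RDiv (entry ''c'' ''k'') (entry ''r'' ''k''))))))"
  let ?P6 = "Cond ?c (IAssign ''k'' (IVar ''j'')) (IAssign ''k'' (IVar ''k''))"
  \<comment> \<open>At \<open>i = 0\<close> the default index \<open>k = 0\<close> equals
    \<open>i\<close>; its gain has just been written into \<open>s5\<close>, so the entry at
    \<open>k\<close> is correct in this case too.\<close>
  have r: "arr s5 ''r'' i = egain I b' i" "arr s5 ''r'' k = egain I b' k" "arr s5 ''c'' i = d i"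
    "arr s5 ''c'' k = d k" "nvar s5 ''k'' = k" "nvar s5 ''j'' = i"
    using val kle i s(3) by (auto simp: defs)
  have c: "bval ?c s5 \<longleftrightarrow> live b' i \<and> (\<not> live b' k \<or> ratio b' d i < ratio b' d k)"
    using r by simp
  have k': "k' = (if bval ?c s5 then i else k)"
    unfolding c k'_def k_def by (simp add: Let_def)
  have r6: "runs ?P6 s5 (U + U) ?Q"
  proof (rule runs_Cond[OF s5])
    show "bsmall ?c" by (simp add: small_defs)
    show "runs (IAssign ''k'' (IVar ''j'')) s5 U ?Q" if "bval ?c s5"
      by (rule runs_IAssign[OF _ s6_def s5], rule Q) (use that k' r(5,6) in \<open>auto simp: small_defs simp del: bval.simps\<close>)
    show "runs (IAssign ''k'' (IVar ''k'')) s5 U ?Q" if "\<not> bval ?c s5"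
      by (rule runs_IAssign[OF _ s6_def s5], rule Q) (use that k' r(5,6) in \<open>auto simp: small_defs simp del: bval.simps\<close>)
  qed
  let ?P5 = "RAssign ''r'' (IVar ''j'')
            (RAdd (RMul (cell ''q'') (RMul (cell ''u'') (cell ''R0'')))
                  (RMul (RSub (RConst 1) (cell ''q'')) (RMul (cell ''v'') (cell ''R1''))))"
  have r5: "runs (Seq ?P5 ?P6) s4 (U + (U + U)) ?Q"
    by (rule runs_Seq, rule runs_RAssign[OF _ s5_def s4], rule r6)
       (use val s(3) eg in \<open>simp_all add: small_defs defs\<close>)
  let ?P4 = "RIf (RLess (cell ''h'') (cell ''R0'')) ''v'' (IConst 0) (cell ''h'') (cell ''R0'')"
  have r4: "runs (Seq ?P4 (Seq ?P5 ?P6)) s3 (2 * U + (U + (U + U))) ?Q"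
    by (rule runs_Seq, rule runs_RIf[OF _ s4_def s3], rule r5)
       (use val s(3) in \<open>simp_all add: small_defs defs min u_def v_def\<close>)
  let ?P3 = "RIf (RLess (cell ''h'') (cell ''R1'')) ''u'' (IConst 0) (cell ''h'') (cell ''R1'')"
  have r3: "runs (Seq ?P3 (Seq ?P4 (Seq ?P5 ?P6))) s2 (2 * U + (2 * U + (U + (U + U)))) ?Q"
    by (rule runs_Seq, rule runs_RIf[OF _ s3_def s2], rule r4)
       (use val s(3) in \<open>simp_all add: small_defs defs min u_def v_def\<close>)
  let ?P2 = "RIf (RLess (RConst 0) (entry ''a'' ''j'')) ''q'' (IConst 0)
            (entry ''p'' ''j'') (RSub (RConst 1) (entry ''p'' ''j''))"
  have r2: "runs (Seq ?P2 (Seq ?P3 (Seq ?P4 (Seq ?P5 ?P6)))) s1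
      (2 * U + (2 * U + (2 * U + (U + (U + U))))) ?Q"
    by (rule runs_Seq, rule runs_RIf[OF _ s2_def s1], rule r3)
       (use val s(3) in \<open>simp_all add: small_defs defs q_def\<close>)
  have "runs gain_prog s (2 * U + (2 * U + (2 * U + (2 * U + (U + (U + U)))))) ?Q"
    unfolding gain_prog_def
    by (rule runs_Seq, rule runs_RIf[OF _ s1_def s(2)], rule r2)
       (use val s(3) in \<open>simp_all add: small_defs h_def\<close>)
  then show ?thesis by (rule runs_le) simp
qed

lemma runs_gain_loop:
  assumes "open_at I b'" "rep b b' d s" "sfit E s" "nvar s ''k'' = 0"
  shows "runs (For gain_prog) s (2 * U + n * (13 * U))
    (\<lambda>s'. gain_inv b b' d n s' \<and> sfit E s' \<and> nvar s' ''n'' = n)"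
proof -
  have n: "nvar s ''n'' = n" using assms(2) by (simp add: rep_def)
  have "gain_inv b b' d 0 (setN ''j'' 0 s)" using assms(2,4) by (simp add: gain_inv_def rep_def)
  then have "runs (For gain_prog) s (2 * U + n * (2 * U + 11 * U))
    (\<lambda>s'. gain_inv b b' d n s' \<and> sfit E s' \<and> nvar s' ''n'' = n)"
    by (rule runs_For[where Inv = "gain_inv b b' d", OF assms(3) n])
       (use runs_gain[OF assms(1)] fit_nat in auto)
  then show ?thesis by (rule runs_le) simp
qed

lemma runs_pay_loop:
  assumes reach: "reach I b' d" and op: "open_at I b'"
    and s: "gain_inv b b' d n s" "sfit E s" "arr s ''y'' 0 = ratio b' d (pick I b' d)"
  shows "runs (For (RAssign ''c'' (IVar ''j'')
            (RSub (entry ''c'' ''j'') (RMul (cell ''y'') (entry ''r'' ''j''))))) s (2 * U + n * (3 * U))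
    (\<lambda>s'. rep b b' (pay I b' d) s' \<and> nvar s' ''k'' = pick I b' d \<and> sfit E s')"
proof -
  let ?P = "RAssign ''c'' (IVar ''j'') (RSub (entry ''c'' ''j'') (RMul (cell ''y'') (entry ''r'' ''j'')))"
  let ?d = "\<lambda>i l. if l < i then pay I b' d l else d l"
  define Inv where "Inv i s \<longleftrightarrow> rep b b' (?d i) s \<and> (\<forall>l<n. arr s ''r'' l = egain I b' l) \<and>
    nvar s ''k'' = pick I b' d \<and> arr s ''y'' 0 = ratio b' d (pick I b' d)" for i s
  have step: "runs ?P s U (\<lambda>s'. Inv (Suc i) (setN ''j'' (Suc i) s') \<and>
      sfit E s' \<and> nvar s' ''j'' = i \<and> nvar s' ''n'' = n)" (is "runs _ _ _ ?Q")
    if i: "i < n" and s: "Inv i s" "sfit E s" "nvar s ''j'' = i" "nvar s ''n'' = n" for i s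
  proof -
    define s1 where "s1 = setA ''c'' i (pay I b' d i) s"
    \<comment> \<open>The residual costs after the round do not depend on the answer, so
      \<open>reach.step\<close> bounds them before the answer is looked up.\<close>
    have s1: "sfit E s1"
      unfolding s1_def by (rule sfit_setA[OF s(2) fit_residual[OF reach.step[OF reach op] i]])
    have val: "arr s ''c'' i = d i" "arr s ''r'' i = egain I b' i"
      "arr s ''y'' 0 = ratio b' d (pick I b' d)"
      using s(1) i by (simp_all add: Inv_def rep_def)
    have "Inv (Suc i) (setN ''j'' (Suc i) s1)"
      using s(1) by (auto simp: Inv_def rep_def s1_def less_Suc_eq)
    then have "?Q s1" using s1 s(3,4) by (simp add: s1_def)
    then show ?thesis
      by (rule runs_RAssign[OF _ s1_def s(2)]) (use val s(3) in \<open>simp_all add: small_defs pay_def\<close>)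
  qed
  have n: "nvar s ''n'' = n" using s(1) by (simp add: gain_inv_def rep_def)
  have "Inv 0 (setN ''j'' 0 s)" using s(1,3) by (simp add: Inv_def gain_inv_def rep_def pick_def)
  then have "runs (For ?P) s (2 * U + n * (2 * U + U)) (\<lambda>s'. Inv n s' \<and> sfit E s' \<and> nvar s' ''n'' = n)"
    by (rule runs_For[where Inv = Inv, OF s(2) n]) (use step fit_nat in auto)
  then show ?thesis by (rule runs_mono) (simp_all add: Inv_def rep_def)
qed

lemma runs_update:
  assumes s: "rep b b' d s" "sfit E s" "nvar s ''k'' = k"
    and k: "k < n" "b' k = None" "coef I k \<noteq> 0" "b k = Some v"
  shows "runs update_prog s (6 * U) (\<lambda>s'. rep b (b'(k \<mapsto> v)) d s' \<and> sfit E s')"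
    (is "runs _ _ _ ?Q")
proof -
  let ?b = "b'(k \<mapsto> v)"
  define t where "t = coef I k * (2 * of_bool v - 1)"
  have val: "arr s ''a'' k = of_int (coef I k)" "arr s ''b'' k = of_bool v"
    "arr s ''R1'' 0 = of_int (need1 I b')" "arr s ''R0'' 0 = of_int (need0 I b')"
    using s(1) k by (simp_all add: rep_def rem_coef_def)
  have t: "\<bar>t\<bar> \<le> magnitude I" using abs_coef_le_magnitude[OF k(1)] by (cases v) (auto simp: t_def)
  have R: "need1 I ?b = (if 0 < t then need1 I b' - t else need1 I b')"
    "need0 I ?b = (if 0 < t then need0 I b' else need0 I b' + t)"
    unfolding need1_upd[where b = b', OF k(1,2)] need0_upd[where b = b', OF k(1,2)] t_def
    using k(3) by (cases v; cases "0 < coef I k"; simp)+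
  have f: "fits E (of_int t)" "fits E (of_int (need1 I ?b))" "fits E (of_int (need0 I ?b))"
    using t abs_need1_le abs_need0_le fit_int by blast+
  define s1 where "s1 = setA ''h'' 0 (of_int t) s"
  define s2 where "s2 = setA ''R1'' 0 (of_int (need1 I ?b)) s1"
  define s3 where "s3 = setA ''R0'' 0 (of_int (need0 I ?b)) s2"
  define s4 where "s4 = setA ''a'' k 0 s3"
  have s1: "sfit E s1" unfolding s1_def by (rule sfit_setA[OF s(2) f(1)])
  have s2: "sfit E s2" unfolding s2_def by (rule sfit_setA[OF s1 f(2)])
  have s3: "sfit E s3" unfolding s3_def by (rule sfit_setA[OF s2 f(3)])
  have s4: "sfit E s4" unfolding s4_def by (rule sfit_setA[OF s3 fit_const(1)])
  note defs = s1_def s2_def s3_def s4_def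
  have Q: "?Q s4" using s(1) s4 by (auto simp: rep_def defs rem_coef_def)
  let ?P4 = "RAssign ''a'' (IVar ''k'') (RConst 0)"
  have r4: "runs ?P4 s3 U ?Q"
    by (rule runs_RAssign[OF _ s4_def s3], rule Q) (use s(3) in \<open>simp_all add: small_defs defs\<close>)
  let ?P3 = "RIf (RLess (RConst 0) (cell ''h'')) ''R0'' (IConst 0)
            (cell ''R0'') (RAdd (cell ''R0'') (cell ''h''))"
  have r3: "runs (Seq ?P3 ?P4) s2 (2 * U + U) ?Q"
    by (rule runs_Seq, rule runs_RIf[OF _ s3_def s2], rule r4)
       (use val R in \<open>simp_all add: small_defs defs\<close>)
  let ?P2 = "RIf (RLess (RConst 0) (cell ''h'')) ''R1'' (IConst 0)
            (RSub (cell ''R1'') (cell ''h'')) (cell ''R1'')"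
  have r2: "runs (Seq ?P2 (Seq ?P3 ?P4)) s1 (2 * U + (2 * U + U)) ?Q"
    by (rule runs_Seq, rule runs_RIf[OF _ s2_def s1], rule r3)
       (use val R in \<open>simp_all add: small_defs defs\<close>)
  have "runs update_prog s (U + (2 * U + (2 * U + U))) ?Q"
    unfolding update_prog_def
    by (rule runs_Seq, rule runs_RAssign[OF _ s1_def s(2)], rule r2)
       (use val s(3) in \<open>simp_all add: small_defs t_def\<close>)
  then show ?thesis by (rule runs_le) simp
qed

text \<open>When a test is requested, positivity of \<open>R1\<close> is kept in the postcondition:
  it stops the final conditional of the program from overwriting the request.\<close>

lemma runs_round:
  assumes reach: "reach I b' d" and op: "open_at I b'" and s: "rep b b' d s" "sfit E s"
  defines "k \<equiv> pick I b' d"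
  shows "runs round_prog s (13 * U + n * (16 * U)) (\<lambda>s'. sfit E s' \<and>
    (case b k of None \<Rightarrow> nvar s' ''result'' = k + 2 \<and> 0 < arr s' ''R1'' 0
     | Some v \<Rightarrow> rep b (b'(k \<mapsto> v)) (pay I b' d) s'))"
    (is "runs _ _ _ ?Q")
proof -
  note pk = pick[OF valid op, where d = d, folded k_def]
  let ?C = "Cond (RLess (RConst 1) (entry ''b'' ''k''))
       (IAssign ''result'' (IAdd (IVar ''k'') (IConst 2))) update_prog"
  have rC: "runs ?C s (U + 6 * U) ?Q"
    if s: "rep b b' (pay I b' d) s" "nvar s ''k'' = k" "sfit E s" for s
  proof (rule runs_Cond[OF s(3)])
    have bk: "arr s ''b'' k = (case b k of None \<Rightarrow> 2 | Some v \<Rightarrow> of_bool v)"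
      using s(1) pk(1) by (simp add: rep_def)
    show "bsmall (RLess (RConst 1) (entry ''b'' ''k''))" by (simp add: small_defs)
    show "runs (IAssign ''result'' (IAdd (IVar ''k'') (IConst 2))) s (6 * U) ?Q"
      if "bval (RLess (RConst 1) (entry ''b'' ''k'')) s"
    proof -
      have None: "b k = None" using that bk s(2) by (cases "b k") (auto simp: of_bool_def split: if_splits)
      have "sfit E (setN ''result'' (k + 2) s)" using s(3) fit_nat[of "k + 2"] pk(1) by (intro sfit_setN) auto
      then have "?Q (setN ''result'' (k + 2) s)"
        using None s(1) op by (simp add: rep_def open_at_def)
      then have "runs (IAssign ''result'' (IAdd (IVar ''k'') (IConst 2))) s U ?Q"
        by (rule runs_IAssign[OF _ refl s(3)]) (use s(2) in \<open>simp_all add: small_defs\<close>)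
      then show ?thesis by (rule runs_le) simp
    qed
    show "runs update_prog s (6 * U) ?Q" if h: "\<not> bval (RLess (RConst 1) (entry ''b'' ''k'')) s"
    proof -
      obtain v where v: "b k = Some v" using h bk s(2) by (auto split: option.splits)
      show ?thesis
        by (rule runs_mono[OF runs_update[OF s(1,3,2) pk(1,3,4) v]]) (use v in simp_all)
    qed
  qed
  let ?L = "For (RAssign ''c'' (IVar ''j'')
            (RSub (entry ''c'' ''j'') (RMul (cell ''y'') (entry ''r'' ''j''))))"
  have rL: "runs (Seq ?L ?C) s ((2 * U + n * (3 * U)) + (U + 6 * U)) ?Q"
    if "gain_inv b b' d n s" "sfit E s" "arr s ''y'' 0 = ratio b' d k" for s
    by (rule runs_Seq, rule runs_mono[OF runs_pay_loop[OF reach op that[unfolded k_def]] order_refl])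
       (use rC in \<open>simp add: k_def\<close>)
  let ?Y = "RAssign ''y'' (IConst 0) (RDiv (entry ''c'' ''k'') (entry ''r'' ''k''))"
  have rY: "runs (Seq ?Y (Seq ?L ?C)) s (U + ((2 * U + n * (3 * U)) + (U + 6 * U))) ?Q"
    if g: "gain_inv b b' d n s" and s: "sfit E s" for s
  proof (rule runs_Seq, rule runs_RAssign[OF _ refl s, where i = 0 and v = "ratio b' d k"])
    show "runs (Seq ?L ?C) (setA ''y'' 0 (ratio b' d k) s) ((2 * U + n * (3 * U)) + (U + 6 * U)) ?Q"
    proof (rule rL)
      show "gain_inv b b' d n (setA ''y'' 0 (ratio b' d k) s)" using g by (simp add: gain_inv_def rep_def)
      show "sfit E (setA ''y'' 0 (ratio b' d k) s)" by (rule sfit_setA[OF s fit_ratio[OF reach op pk(1)]])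
    qed simp
    show "rval (RDiv (entry ''c'' ''k'') (entry ''r'' ''k'')) s = ratio b' d k"
      using g pk(1) by (simp add: gain_inv_def rep_def k_def pick_def)
  qed (simp_all add: small_defs)
  let ?s = "setN ''k'' 0 s"
  have "sfit E ?s" "rep b b' d ?s" using s fit_const by (auto intro: sfit_setN simp: rep_def)
  then have "runs (Seq (For gain_prog) (Seq ?Y (Seq ?L ?C))) ?s
     ((2 * U + n * (13 * U)) + (U + ((2 * U + n * (3 * U)) + (U + 6 * U)))) ?Q"
    by (intro runs_Seq runs_mono[OF runs_gain_loop[OF op] order_refl rY]) auto
  then have "runs round_prog s (U + ((2 * U + n * (13 * U)) + (U + ((2 * U + n * (3 * U)) + (U + 6 * U))))) ?Q"
    unfolding round_prog_def
    by (intro runs_Seq, elim runs_IAssign[OF _ refl s(2)]) (simp_all add: small_defs)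
  then show ?thesis by (rule runs_le) (simp add: algebra_simps)
qed

text \<open>The postcondition is the precondition of the final conditional: once \<open>R1\<close>
  is exhausted the decision must be 1, which is stored only after the loop.\<close>

lemma runs_loop:
  assumes "replay I b b' d m u" "reach I b' d" "rep b b' d s" "sfit E s"
  shows "runs (While (BAnd (RLess (RConst 0) (cell ''R1''))
       (BAnd (RLess (RConst 0) (cell ''R0'')) (ILess (IVar ''result'') (IConst 1)))) round_prog)
     s (2 * U + m * (15 * U + n * (16 * U)))
     (\<lambda>s'. sfit E s' \<and> (if 0 < arr s' ''R1'' 0 then nvar s' ''result'' = u else u = 1))"
    (is "runs (While ?c _) _ _ (?Q u)")
  using assms
proof (induction arbitrary: s)
  have small: "bsmall ?c" by (simp add: small_defs)
  {
    case (Done b' d)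
    then have "runs (While ?c round_prog) s U (?Q (of_bool (need1 I b' \<le> 0)))"
      by (intro runs_While_False[OF _ small]) (auto simp: rep_def open_at_def)
    then show ?case by (rule runs_le) simp
  next
    case (Ask b' d)
    let ?k = "pick I b' d"
    have fin: "runs (While ?c round_prog) s' U (?Q (?k + 2))"
      if "sfit E s' \<and> nvar s' ''result'' = ?k + 2 \<and> 0 < arr s' ''R1'' 0" for s'
      using that by (intro runs_While_False[OF _ small]) auto
    have "runs round_prog s (13 * U + n * (16 * U)) (\<lambda>s'. runs (While ?c round_prog) s' U (?Q (?k + 2)))"
      by (rule runs_mono[OF runs_round[OF Ask.prems(1) Ask.hyps(1) Ask.prems(2,3)] order_refl], rule fin)
         (simp add: Ask.hyps(2))
    then have "runs (While ?c round_prog) s (U + (13 * U + n * (16 * U)) + U) (?Q (?k + 2))"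
      using Ask by (intro runs_While_True[OF _ small]) (auto simp: rep_def open_at_def)
    then show ?case by (rule runs_le) simp
  next
    case (Known b' d v m u)
    let ?k = "pick I b' d"
    let ?K = "2 * U + m * (15 * U + n * (16 * U))"
    have fin: "runs (While ?c round_prog) s' ?K (?Q u)"
      if "sfit E s' \<and> rep b (b'(?k \<mapsto> v)) (pay I b' d) s'" for s'
      using that Known.IH[OF reach.step[OF Known.prems(1) Known.hyps(1)]] by blast
    have "runs round_prog s (13 * U + n * (16 * U)) (\<lambda>s'. runs (While ?c round_prog) s' ?K (?Q u))"
      by (rule runs_mono[OF runs_round[OF Known.prems(1) Known.hyps(1) Known.prems(2,3)] order_refl], rule fin)
         (simp add: Known.hyps(2))
    then have "runs (While ?c round_prog) s (U + (13 * U + n * (16 * U)) + ?K) (?Q u)"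
      using Known by (intro runs_While_True[OF _ small]) (auto simp: rep_def open_at_def)
    then show ?case by (rule runs_le) simp
  }
qed

lemma runs_greedy_prog:
  assumes "replay I b Map.empty (cost I) m u"
  shows "runs greedy_prog (initial_state I b) (8 * U + n * (6 * U) + m * (15 * U + n * (16 * U)))
    (\<lambda>s. nvar s ''result'' = u)"
proof -
  let ?c = "RLess (RConst 0) (cell ''R1'')"
  let ?W = "While (BAnd (RLess (RConst 0) (cell ''R1''))
       (BAnd (RLess (RConst 0) (cell ''R0'')) (ILess (IVar ''result'') (IConst 1)))) round_prog"
  let ?F = "Cond ?c (IAssign ''result'' (IVar ''result'')) (IAssign ''result'' (IConst 1))"
  let ?Q = "\<lambda>s. nvar s ''result'' = u"
  have rF: "runs ?F s (U + U) ?Q"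
    if s: "sfit E s \<and> (if 0 < arr s ''R1'' 0 then nvar s ''result'' = u else u = 1)" for s
    using s by (intro runs_Cond runs_IAssign[OF _ refl, where v = u]) (auto simp: small_defs)
  have rW: "runs (Seq ?W ?F) s ((2 * U + m * (15 * U + n * (16 * U))) + (U + U)) ?Q"
    if "sfit E s \<and> rep b Map.empty (cost I) s" for s
    using that by (intro runs_Seq runs_mono[OF runs_loop[OF assms reach.start] order_refl rF]) auto
  have "runs greedy_prog (initial_state I b)
    ((4 * U + n * (6 * U)) + ((2 * U + m * (15 * U + n * (16 * U))) + (U + U))) ?Q"
    unfolding greedy_prog_def by (intro runs_Seq runs_mono[OF runs_init order_refl rW])
  then show ?thesis by (rule runs_le) simp
qed

text \<open>A replay exists for every \<open>b\<close>, also for observations that no greedy run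
  produces, and each round but the last replays a new variable.\<close>

lemma greedy_prog_time:
  "runs greedy_prog (initial_state I b) (30 * U * (n + 1) ^ 2) (\<lambda>s. True)"
proof -
  obtain m u where m: "replay I b Map.empty (cost I) m u" "m \<le> card ({..<n} - dom (Map.empty :: nat \<rightharpoonup> bool)) + 1"
    using replay_exists[OF valid, of b Map.empty "cost I"] by blast
  then have "m \<le> n + 1" by simp
  then have "m * (15 * U + n * (16 * U)) \<le> (n + 1) * (15 * U + n * (16 * U))" by (rule mult_le_mono1)
  \<comment> \<open>The left side is 16 n^2 + 37 n + 23 times \<open>U\<close>.\<close>
  also have "8 * U + n * (6 * U) + (n + 1) * (15 * U + n * (16 * U)) \<le> 30 * U * (n + 1) ^ 2"
    by (simp add: power2_eq_square algebra_simps)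
  finally show ?thesis by (intro runs_mono[OF runs_greedy_prog[OF m(1)]]) auto
qed

end

section \<open>The real and the logarithmic cost model\<close>

lemma greedy_machine_unit:
  assumes "valid_instance I"
  shows "greedy_machine unit_weight (\<lambda>_ _. True) I 0"
  using assms by unfold_locales (auto simp: unit_weight_def)

lemma greedy_machine_bit:
  assumes "valid_instance I" "rational_instance I"
  shows "greedy_machine bit_weight fits_bits I (bit_level (instance_size bit_weight I))"
proof (unfold_locales)
  fix d e x y
  assume *: "fits_bits d x" "fits_bits e y"
  show "fits_bits (d + e + 1) (x * y)" by (rule fits_bits_mono[OF fits_bits_mult[OF *]]) simp
  show "fits_bits (d + e + 1) (x / y)" by (rule fits_bits_mono[OF fits_bits_divide[OF *]]) simp
qed (use assms reach_fits_bits[OF assms] in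
  \<open>auto intro: fits_bits_mono fits_bits_add fits_bits_diff bit_weight_le
    simp del: One_nat_def add_Suc_right\<close>)

lemma greedy_prog_decides:
  assumes "valid_instance I" "reach I b d" "replay I b b d m u"
  obtains t s where "exec unit_weight greedy_prog (initial_state I b) t s" "nvar s ''result'' = u"
proof -
  interpret greedy_machine unit_weight "\<lambda>_ _. True" I 0 by (rule greedy_machine_unit[OF assms(1)])
  obtain m where "replay I b Map.empty (cost I) m u"
    using replay_from_start[OF assms(1,2) map_le_refl assms(3)] by blast
  from runs_greedy_prog[OF this] show ?thesis unfolding runs_def using that by blast
qed

text \<open>\<open>follows\<close> restarts the program with \<open>b\<close> alone, whereas the
  next test depends on \<open>d\<close>. The assumption \<open>reach I b d\<close> ties
  \<open>d\<close> to the run that the program recomputes.\<close>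

lemma greedy_follows:
  assumes "valid_instance I" "greedy I b d T" "reach I b d"
  shows "follows greedy_prog I b T"
  using assms(2,3)
proof induction
  case (Output b d)
  obtain t s where "exec unit_weight greedy_prog (initial_state I b) t s"
    "nvar s ''result'' = of_bool (need1 I b \<le> 0)"
    using greedy_prog_decides[OF assms(1) Output.prems replay.Done[OF Output.hyps]] by blast
  then show ?case by (rule follows.Output)
next
  case (Test b k d T0 T1)
  have k: "b (pick I b d) = None" using pick(3)[OF assms(1) Test.hyps(1)] .
  obtain t s where "exec unit_weight greedy_prog (initial_state I b) t s"
    "nvar s ''result'' = pick I b d + 2"
    using greedy_prog_decides[OF assms(1) Test.prems replay.Ask[where b = b and d = d, OF Test.hyps(1) k]]
    by blast
  then have "exec unit_weight greedy_prog (initial_state I b) t s" "nvar s ''result'' = k + 2"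
    using Test.hyps(2) by simp_all
  then show ?case
    using Test.IH reach.step[OF Test.prems Test.hyps(1)] unfolding Test.hyps(2)
    by (blast intro: follows.Test)
qed

lemma poly_timeI:
  assumes "\<And>I b. I \<in> A \<Longrightarrow> \<exists>t s. exec w P (initial_state I b) t s \<and> t \<le> C * (instance_size w I + 1) ^ k"
  shows "poly_time w A P"
  unfolding poly_time_def
proof (intro exI[of _ "smult C ([:1, 1:] ^ k)"] ballI allI impI)
  fix I b assume "I \<in> A"
  then show "\<exists>t s. exec w P (initial_state I b) t s \<and> t \<le> poly (smult C ([:1, 1:] ^ k)) (instance_size w I)"
    using assms[of I b] by (simp add: poly_power add.commute)
qed

lemma poly_time_unit: "poly_time unit_weight {I. valid_instance I} greedy_prog"
proof (rule poly_timeI)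
  fix I b assume "I \<in> {I. valid_instance I}"
  then interpret greedy_machine unit_weight "\<lambda>_ _. True" I 0 by (intro greedy_machine_unit) simp
  let ?L = "instance_size unit_weight I"
  obtain t s where ts: "exec unit_weight greedy_prog (initial_state I b) t s"
    "t \<le> 30 * U * (n + 1) ^ 2" using greedy_prog_time[of b] unfolding runs_def by blast
  have "(n + 1) ^ 2 \<le> (?L + 1) ^ 2"
    using dim_le_instance_size[of I unit_weight] by (intro power_mono) auto
  then have "30 * U * (n + 1) ^ 2 \<le> 300000 * (?L + 1) ^ 2" unfolding unit_time_def by simp
  then show "\<exists>t s. exec unit_weight greedy_prog (initial_state I b) t s \<and> t \<le> 300000 * (?L + 1) ^ 2"
    using ts order_trans by blast
qed

lemma poly_time_bit:
  "poly_time bit_weight {I. valid_instance I \<and> rational_instance I} greedy_prog"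
proof (rule poly_timeI)
  fix I b assume I: "I \<in> {I. valid_instance I \<and> rational_instance I}"
  let ?L = "instance_size bit_weight I"
  interpret greedy_machine bit_weight fits_bits I "bit_level ?L"
    by (rule greedy_machine_bit) (use I in auto)
  obtain t s where ts: "exec bit_weight greedy_prog (initial_state I b) t s"
    "t \<le> 30 * U * (n + 1) ^ 2" using greedy_prog_time[of b] unfolding runs_def by blast
  \<comment> \<open>The left side is 5 L^2 + 13 L + 8. Multiplied by the 10000 of
    \<open>unit_time\<close> and the 30 of \<open>greedy_prog_time\<close>, the factor 8 gives
    2400000.\<close>
  have "bit_level ?L + 1 \<le> 8 * (?L + 1) ^ 2"
    by (simp add: bit_level_def power2_eq_square algebra_simps)
  then have U: "U \<le> 80000 * (?L + 1) ^ 2" unfolding unit_time_def by simp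
  have "(n + 1) ^ 2 \<le> (?L + 1) ^ 2"
    using dim_le_instance_size[of I bit_weight] by (intro power_mono) auto
  then have "30 * U * (n + 1) ^ 2 \<le> 30 * (80000 * (?L + 1) ^ 2) * (?L + 1) ^ 2"
    using U by (intro mult_le_mono) auto
  also have "\<dots> = 2400000 * (?L + 1) ^ 4"
    by (simp add: power_add[symmetric] mult.assoc del: add_Suc_right One_nat_def)
  finally show "\<exists>t s. exec bit_weight greedy_prog (initial_state I b) t s \<and> t \<le> 2400000 * (?L + 1) ^ 4"
    using ts order_trans by blast
qed

theorem theorem5:
  "\<exists>P. poly_time bit_weight {I. valid_instance I \<and> rational_instance I} P \<and>
       poly_time unit_weight {I. valid_instance I} P \<and>
       (\<forall>I. valid_instance I \<longrightarrow>
          (\<exists>T\<in>strategies I. follows P I Map.empty T \<and> expected_cost I T \<le> 3 * opt_cost I))"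
proof (intro exI[of _ greedy_prog] conjI allI impI)
  show "poly_time bit_weight {I. valid_instance I \<and> rational_instance I} greedy_prog"
    by (rule poly_time_bit)
  show "poly_time unit_weight {I. valid_instance I} greedy_prog"
    by (rule poly_time_unit)
  fix I assume I: "valid_instance I"
  obtain T where T: "greedy I Map.empty (cost I) T" using greedy_exists[OF I] by blast
  show "\<exists>T\<in>strategies I. follows greedy_prog I Map.empty T \<and> expected_cost I T \<le> 3 * opt_cost I"
    using greedy_cost_le_opt[OF I T] greedy_follows[OF I T reach.start] by blast
qed

end
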